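(* Let $w\in S_n$ and $M(w)=\{[w(i),i+n]:1\le i\le n\}$, so that $\Sigma_{M(w)}\subseteq\operatorname{Gr}(n,2n)$. Then the flat limit $\lim_{t\to0}\phi_{t,w}\Sigma_{M(w)}$ contains the diagram variety $X_{D(w)}$ as an irreducible component.
   Context: A rank set is a finite set of intervals $[a_i,b_i]$ of positive integers with distinct left endpoints and distinct right endpoints; for a set $S$, $S(M)$ is the set of intervals of $M$ contained in $S$. The rank variety $\Sigma_M\subseteq\operatorname{Gr}(\#M,m)$ is the closure of $\{V:\dim(V\cap\langle S\cap T\rangle)=\#(S\cap T)(M)\ \forall S,T\in M\}$, $\langle X\rangle$ being the span of standard basis vectors $e_i$, $i\in X$. $\phi_{t,i\to j}$ is the linear map of $\mathbb{C}^{2n}$ sending $e_i\mapsto te_i+(1-t)e_j$ and fixing other $e_p$; $\phi_{t,w}=\phi_{t,n+1\to w(1)}\circ\phi_{t,n+2\to w(2)}\circ\cdots\circ\phi_{t,2n\to w(n)}$. For $t\neq0$ the translates $\phi_{t,w}\Sigma_{M(w)}$ form a flat family and the flat limit is its limit scheme at $t=0$. The diagram of $w$ is $D(w)=\{(i,w(j))\in[n]\times[n]: i<j,\ w(i)>w(j)\}$. For $D\subseteq[k]\times[m-k]$, the diagram variety $X_D\subseteq\operatorname{Gr}(k,m)$ is the closure of $\{\operatorname{rowspan}[A\mid I_k]:A\in M_{k,m-k}(\mathbb{C}),\ A_{ij}=0\text{ for }(i,j)\in D\}$; here $k=n$, $m=2n$. *)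

theory Defs
  imports
    "HOL-Library.Function_Algebras"
    "HOL-Combinatorics.Permutations"
    "HOL-Analysis.Abstract_Topology"
    "Jordan_Normal_Form.Determinant"
begin

section \<open>Linear algebra\<close>

text \<open>
  The space \<open>\<complex>\<^sup>m\<close> is realised inside the complex vector space of all functions
  \<open>nat \<Rightarrow> complex\<close>, as the span of the standard basis vectors with index in \<open>{1..m}\<close>.
\<close>

definition cscale :: "complex \<Rightarrow> (nat \<Rightarrow> complex) \<Rightarrow> (nat \<Rightarrow> complex)" where
  "cscale c v = (\<lambda>i. c * v i)"

global_interpretation cv: vector_space cscale
  by unfold_locales (auto simp: cscale_def algebra_simps fun_eq_iff)

definition basis_vec :: "nat \<Rightarrow> (nat \<Rightarrow> complex)" where
  "basis_vec i = (\<lambda>j. if j = i then 1 else 0)"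

definition coord_span :: "nat set \<Rightarrow> (nat \<Rightarrow> complex) set" where
  "coord_span X = cv.span (basis_vec ` X)"

definition Gr :: "nat \<Rightarrow> nat \<Rightarrow> (nat \<Rightarrow> complex) set set" where
  "Gr k m = {V. cv.subspace V \<and> V \<subseteq> coord_span {1..m} \<and> cv.dim V = k}"


section \<open>The Zariski topology of the Grassmannian\<close>

text \<open>
  Closed subsets of \<open>Gr k m\<close> are the zero loci of homogeneous polynomials in the Pluecker
  coordinates, which are indexed by the \<open>k\<close>-element subsets of \<open>{1..m}\<close>.
  As \<open>\<complex>\<close> is infinite, polynomials are identified with polynomial functions.
\<close>

inductive_set poly_funs :: "'v set \<Rightarrow> (('v \<Rightarrow> complex) \<Rightarrow> complex) set"
  for X :: "'v set" where
  const: "(\<lambda>_. c) \<in> poly_funs X"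
| var: "x \<in> X \<Longrightarrow> (\<lambda>p. p x) \<in> poly_funs X"
| add: "f \<in> poly_funs X \<Longrightarrow> g \<in> poly_funs X \<Longrightarrow> (\<lambda>p. f p + g p) \<in> poly_funs X"
| mult: "f \<in> poly_funs X \<Longrightarrow> g \<in> poly_funs X \<Longrightarrow> (\<lambda>p. f p * g p) \<in> poly_funs X"

definition forms :: "nat \<Rightarrow> nat \<Rightarrow> nat \<Rightarrow> ((nat set \<Rightarrow> complex) \<Rightarrow> complex) set" where
  "forms k m d = {f \<in> poly_funs {I. I \<subseteq> {1..m} \<and> card I = k}.
     \<forall>c p. f (\<lambda>I. c * p I) = c ^ d * f p}"

text \<open>The maximal minor with column set \<open>I\<close> of the matrix with rows \<open>b 1, \<dots>, b k\<close>.\<close>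

definition pluecker :: "nat \<Rightarrow> (nat \<Rightarrow> nat \<Rightarrow> complex) \<Rightarrow> nat set \<Rightarrow> complex" where
  "pluecker k b I = det (mat k k (\<lambda>(r, c). b (Suc r) (sorted_list_of_set I ! c)))"

definition vanishes_at ::
    "nat \<Rightarrow> ((nat set \<Rightarrow> complex) \<Rightarrow> complex) \<Rightarrow> (nat \<Rightarrow> complex) set \<Rightarrow> bool" where
  "vanishes_at k f V \<longleftrightarrow> (\<forall>b. cv.span (b ` {1..k}) = V \<longrightarrow> f (pluecker k b) = 0)"

definition zero_locus ::
    "nat \<Rightarrow> nat \<Rightarrow> ((nat set \<Rightarrow> complex) \<Rightarrow> complex) set \<Rightarrow> (nat \<Rightarrow> complex) set set" where
  "zero_locus k m F = {V \<in> Gr k m. \<forall>f\<in>F. vanishes_at k f V}"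

definition zariski :: "nat \<Rightarrow> nat \<Rightarrow> (nat \<Rightarrow> complex) set topology" where
  "zariski k m = topology (\<lambda>U. \<exists>F \<subseteq> (\<Union>d. forms k m d). U = Gr k m - zero_locus k m F)"

lemma forms_mult:
  assumes "f \<in> forms k m d" "g \<in> forms k m d'"
  shows "(\<lambda>p. f p * g p) \<in> forms k m (d + d')"
  using assms by (auto simp: forms_def power_add intro: poly_funs.mult)

lemma forms_const: "(\<lambda>_. c) \<in> forms k m 0"
  by (auto simp: forms_def intro: poly_funs.const)

lemma Gr_spanning_family:
  assumes "V \<in> Gr k m"
  obtains b where "cv.span (b ` {1..k}) = V"
proof -
  have V: "cv.subspace V" "V \<subseteq> coord_span {1..m}" "cv.dim V = k"
    using assms by (auto simp: Gr_def)
  obtain B where B: "B \<subseteq> V" "cv.independent B" "V \<subseteq> cv.span B" "card B = cv.dim V"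
    using cv.basis_exists by blast
  have "B \<subseteq> cv.span (basis_vec ` {1..m})"
    using B(1) V(2) by (auto simp: coord_span_def)
  hence "finite B"
    using cv.independent_span_bound[OF _ B(2)] by blast
  then obtain h where "bij_betw h {1..card B} B"
    by (metis ex_bij_betw_nat_finite_1)
  hence "h ` {1..k} = B"
    using B(4) V(3) by (auto simp: bij_betw_def)
  moreover have "cv.span B = V"
    using B(1,3) V(1) by (meson cv.span_minimal subset_antisym)
  ultimately show ?thesis using that by metis
qed

lemma in_span_family:
  assumes "v \<in> cv.span (b ` {1..k})"
  shows "\<exists>a. \<forall>j. v j = (\<Sum>i<k. a i * b (Suc i) j)"
  using assms
proof (induction rule: cv.span_induct_alt)
  case base
  show ?case by (rule exI[of _ "\<lambda>_. 0"]) auto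
next
  case (step c x y)
  from step obtain a where a: "\<And>j. y j = (\<Sum>i<k. a i * b (Suc i) j)" by blast
  from step obtain i where i: "i \<in> {1..k}" "x = b i" by blast
  then obtain i' where i': "i = Suc i'" "i' < k" by (cases i) auto
  have "(cscale c x + y) j = (\<Sum>l<k. (a l + (if l = i' then c else 0)) * b (Suc l) j)" for j
  proof -
    have "(\<Sum>l<k. (a l + (if l = i' then c else 0)) * b (Suc l) j) =
          (\<Sum>l<k. a l * b (Suc l) j) + (\<Sum>l<k. (if l = i' then c * b (Suc l) j else 0))"
      by (subst sum.distrib[symmetric], rule sum.cong) (auto simp: algebra_simps)
    also have "\<dots> = y j + c * b i j" using i' by (simp add: a)
    finally show ?thesis by (simp add: cscale_def i)
  qed
  thus ?case by (intro exI[of _ "\<lambda>l. a l + (if l = i' then c else 0)"]) blast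
qed

lemma pluecker_change_basis:
  assumes "cv.span (b ` {1..k}) = cv.span (b' ` {1..k})"
  shows "\<exists>c. \<forall>I. pluecker k b' I = c * pluecker k b I"
proof -
  have "\<exists>a. \<forall>j. b' (Suc r) j = (\<Sum>i<k. a i * b (Suc i) j)" if "r < k" for r
  proof (rule in_span_family)
    show "b' (Suc r) \<in> cv.span (b ` {1..k})"
      unfolding assms using that by (intro cv.span_base) auto
  qed
  then obtain a where a: "\<And>r j. r < k \<Longrightarrow> b' (Suc r) j = (\<Sum>i<k. a r i * b (Suc i) j)"
    by metis
  have "pluecker k b' I = det (mat k k (\<lambda>(r, i). a r i)) * pluecker k b I" for I
  proof -
    have "mat k k (\<lambda>(r, c). b' (Suc r) (sorted_list_of_set I ! c)) =
          mat k k (\<lambda>(r, i). a r i) * mat k k (\<lambda>(r, c). b (Suc r) (sorted_list_of_set I ! c))"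
      by (rule eq_matI) (auto simp: scalar_prod_def a lessThan_atLeast0)
    thus ?thesis unfolding pluecker_def
      by (simp add: det_mult[of _ k])
  qed
  thus ?thesis by blast
qed

lemma vanishes_at_iff:
  assumes "f \<in> forms k m d" "cv.span (b ` {1..k}) = V"
  shows "vanishes_at k f V \<longleftrightarrow> f (pluecker k b) = 0"
proof
  assume f0: "f (pluecker k b) = 0"
  show "vanishes_at k f V"
    unfolding vanishes_at_def
  proof (intro allI impI)
    fix b' assume "cv.span (b' ` {1..k}) = V"
    then obtain c where "pluecker k b' = (\<lambda>I. c * pluecker k b I)"
      using pluecker_change_basis[of b k b'] assms(2) by auto
    thus "f (pluecker k b') = 0"
      using assms(1) f0 by (simp add: forms_def)
  qed
qed (use assms(2) in \<open>auto simp: vanishes_at_def\<close>)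

lemma vanishes_at_mult:
  assumes "f \<in> forms k m d" "g \<in> forms k m d'" "V \<in> Gr k m"
  shows "vanishes_at k (\<lambda>p. f p * g p) V \<longleftrightarrow> vanishes_at k f V \<or> vanishes_at k g V"
proof -
  obtain b where b: "cv.span (b ` {1..k}) = V" using Gr_spanning_family assms(3) by blast
  show ?thesis
    unfolding vanishes_at_iff[OF assms(1) b] vanishes_at_iff[OF assms(2) b]
      vanishes_at_iff[OF forms_mult[OF assms(1,2)] b] by simp
qed

lemma istopology_zariski:
  "istopology (\<lambda>U. \<exists>F \<subseteq> (\<Union>d. forms k m d). U = Gr k m - zero_locus k m F)"
  unfolding istopology_def
proof (intro conjI allI impI)
  fix S T
  assume "\<exists>F \<subseteq> (\<Union>d. forms k m d). S = Gr k m - zero_locus k m F"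
    and "\<exists>F \<subseteq> (\<Union>d. forms k m d). T = Gr k m - zero_locus k m F"
  then obtain F G where F: "F \<subseteq> (\<Union>d. forms k m d)" "S = Gr k m - zero_locus k m F"
    and G: "G \<subseteq> (\<Union>d. forms k m d)" "T = Gr k m - zero_locus k m G" by blast
  define H where "H = (\<lambda>(f, g). (\<lambda>p. f p * g p)) ` (F \<times> G)"
  have "H \<subseteq> (\<Union>d. forms k m d)"
    unfolding H_def using F(1) G(1) by (fastforce dest: subsetD intro: forms_mult)
  moreover have "S \<inter> T = Gr k m - zero_locus k m H"
  proof -
    have "vanishes_at k (\<lambda>p. f p * g p) V \<longleftrightarrow> vanishes_at k f V \<or> vanishes_at k g V"
      if "f \<in> F" "g \<in> G" "V \<in> Gr k m" for f g V
      using that F(1) G(1) vanishes_at_mult by blast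
    thus ?thesis
      unfolding F(2) G(2) zero_locus_def H_def by auto
  qed
  ultimately show "\<exists>F \<subseteq> (\<Union>d. forms k m d). S \<inter> T = Gr k m - zero_locus k m F" by blast
next
  fix K
  assume "\<forall>U\<in>K. \<exists>F \<subseteq> (\<Union>d. forms k m d). U = Gr k m - zero_locus k m F"
  then obtain F where F: "\<And>U. U \<in> K \<Longrightarrow> F U \<subseteq> (\<Union>d. forms k m d)"
    "\<And>U. U \<in> K \<Longrightarrow> U = Gr k m - zero_locus k m (F U)" by metis
  have "\<Union>K = (\<Union>U\<in>K. Gr k m - zero_locus k m (F U))" using F(2) by auto
  also have "\<dots> = Gr k m - zero_locus k m (\<Union>U\<in>K. F U)"
    by (auto simp: zero_locus_def)
  finally show "\<exists>F \<subseteq> (\<Union>d. forms k m d). \<Union>K = Gr k m - zero_locus k m F"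
    using F(1) by (intro exI[of _ "\<Union>U\<in>K. F U"]) blast
qed

lemma openin_zariski:
  "openin (zariski k m) U \<longleftrightarrow> (\<exists>F \<subseteq> (\<Union>d. forms k m d). U = Gr k m - zero_locus k m F)"
  unfolding zariski_def using istopology_zariski by (simp add: topology_inverse')

lemma topspace_zariski: "topspace (zariski k m) = Gr k m"
proof -
  have "zero_locus k m {\<lambda>_. 1} = {}"
    using Gr_spanning_family by (force simp: zero_locus_def vanishes_at_def)
  hence "openin (zariski k m) (Gr k m)"
    unfolding openin_zariski using forms_const[of 1 k m]
    by (intro exI[of _ "{\<lambda>_. 1}"]) (auto intro: exI[of _ 0])
  thus ?thesis
    unfolding topspace_def openin_zariski by blast
qed

lemma closedin_zariski:
  "closedin (zariski k m) Z \<longleftrightarrow> (\<exists>F \<subseteq> (\<Union>d. forms k m d). Z = zero_locus k m F)"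
proof -
  have "zero_locus k m F \<subseteq> Gr k m" for F by (auto simp: zero_locus_def)
  thus ?thesis
    unfolding closedin_def openin_zariski topspace_zariski by (metis double_diff order_refl Diff_subset)
qed


section \<open>Irreducible components\<close>

definition irreducible_space :: "'a topology \<Rightarrow> bool" where
  "irreducible_space X \<longleftrightarrow> topspace X \<noteq> {} \<and>
     (\<forall>A B. closedin X A \<and> closedin X B \<and> A \<union> B = topspace X \<longrightarrow>
        A = topspace X \<or> B = topspace X)"

definition irreducible_component_of :: "'a topology \<Rightarrow> 'a set \<Rightarrow> bool" where
  "irreducible_component_of X C \<longleftrightarrow>
     C \<subseteq> topspace X \<and> irreducible_space (subtopology X C) \<and>
     (\<forall>C'. C \<subseteq> C' \<and> C' \<subseteq> topspace X \<and> irreducible_space (subtopology X C') \<longrightarrow> C' = C)"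


section \<open>Flat limits\<close>

text \<open>
  A closed subscheme of \<open>Gr k m\<close> is represented by (the homogeneous elements of) a homogeneous
  ideal in the Pluecker coordinates; its underlying space is the zero locus.
\<close>

definition scheme_space ::
    "nat \<Rightarrow> nat \<Rightarrow> ((nat set \<Rightarrow> complex) \<Rightarrow> complex) set \<Rightarrow> (nat \<Rightarrow> complex) set topology" where
  "scheme_space k m J = subtopology (zariski k m) (zero_locus k m J)"

text \<open>
  Degree \<open>d\<close> forms in the Pluecker coordinates with coefficients polynomial in \<open>t\<close>,
  i.e. elements of \<open>\<complex>[t] \<otimes> forms k m d\<close>.
\<close>

definition family_forms ::
    "nat \<Rightarrow> nat \<Rightarrow> nat \<Rightarrow> (complex \<Rightarrow> (nat set \<Rightarrow> complex) \<Rightarrow> complex) set" where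
  "family_forms k m d = {f. \<exists>N g. (\<forall>i\<le>N. g i \<in> forms k m d) \<and>
     f = (\<lambda>t p. \<Sum>i\<le>N. t ^ i * g i p)}"

text \<open>
  The flat limit of a family \<open>X t\<close> (\<open>t \<noteq> 0\<close>) of subvarieties of \<open>Gr k m\<close> is the fibre at \<open>t = 0\<close>
  of the closure in \<open>\<complex> \<times> Gr k m\<close> of the total space over \<open>\<complex> - {0}\<close>: its ideal consists of the
  specialisations at \<open>t = 0\<close> of the forms vanishing on \<open>X t\<close> for all \<open>t \<noteq> 0\<close>.
\<close>

definition flat_limit ::
    "nat \<Rightarrow> nat \<Rightarrow> (complex \<Rightarrow> (nat \<Rightarrow> complex) set set) \<Rightarrow>
     ((nat set \<Rightarrow> complex) \<Rightarrow> complex) set" where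
  "flat_limit k m X =
     (\<Union>d. {f 0 | f. f \<in> family_forms k m d \<and> (\<forall>t. t \<noteq> 0 \<longrightarrow> (\<forall>V\<in>X t. vanishes_at k (f t) V))})"


section \<open>Rank varieties and diagram varieties\<close>

definition rank_set :: "nat set set \<Rightarrow> bool" where
  "rank_set M \<longleftrightarrow> finite M \<and> (\<forall>S\<in>M. \<exists>a b. 1 \<le> a \<and> a \<le> b \<and> S = {a..b}) \<and>
     inj_on Min M \<and> inj_on Max M"

definition rank_variety :: "nat \<Rightarrow> nat set set \<Rightarrow> (nat \<Rightarrow> complex) set set" where
  "rank_variety m M = zariski (card M) m closure_of
     {V \<in> Gr (card M) m. \<forall>S\<in>M. \<forall>T\<in>M.
        cv.dim (V \<inter> coord_span (S \<inter> T)) = card {R \<in> M. R \<subseteq> S \<inter> T}}"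

definition perm_rank_set :: "nat \<Rightarrow> (nat \<Rightarrow> nat) \<Rightarrow> nat set set" where
  "perm_rank_set n w = {{w i..i + n} | i. i \<in> {1..n}}"

text \<open>The row space of \<open>[A | I\<^sub>k]\<close>, where only the entries \<open>A i j\<close> with
  \<open>i \<in> {1..k}\<close> and \<open>j \<in> {1..m - k}\<close> matter.\<close>

definition rowspan_aug :: "nat \<Rightarrow> nat \<Rightarrow> (nat \<Rightarrow> nat \<Rightarrow> complex) \<Rightarrow> (nat \<Rightarrow> complex) set" where
  "rowspan_aug k m A = cv.span
     ((\<lambda>i j. if j \<in> {1..m - k} then A i j else if j = m - k + i then 1 else 0) ` {1..k})"

definition diagram_variety :: "nat \<Rightarrow> nat \<Rightarrow> (nat \<times> nat) set \<Rightarrow> (nat \<Rightarrow> complex) set set" where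
  "diagram_variety k m D = zariski k m closure_of
     {rowspan_aug k m A | A. \<forall>(i, j)\<in>D. A i j = 0}"

definition perm_diagram :: "nat \<Rightarrow> (nat \<Rightarrow> nat) \<Rightarrow> (nat \<times> nat) set" where
  "perm_diagram n w = {(i, w j) | i j. i \<in> {1..n} \<and> j \<in> {1..n} \<and> i < j \<and> w i > w j}"

definition shift_map :: "complex \<Rightarrow> nat \<Rightarrow> nat \<Rightarrow> (nat \<Rightarrow> complex) \<Rightarrow> (nat \<Rightarrow> complex)" where
  "shift_map t i j v =
     v(i := 0) + cscale (v i) (cscale t (basis_vec i) + cscale (1 - t) (basis_vec j))"

definition perm_shift_map ::
    "nat \<Rightarrow> complex \<Rightarrow> (nat \<Rightarrow> nat) \<Rightarrow> (nat \<Rightarrow> complex) \<Rightarrow> (nat \<Rightarrow> complex)" where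
  "perm_shift_map n t w = foldr (\<circ>) (map (\<lambda>i. shift_map t (n + i) (w i)) [1..<n + 1]) id"

lemma linear_shift_map: "Vector_Spaces.linear cscale cscale (shift_map t i j)"
  by unfold_locales (auto simp: shift_map_def cscale_def algebra_simps fun_eq_iff)

lemma shift_map_basis_vec:
  "shift_map t i j (basis_vec p) =
     (if p = i then cscale t (basis_vec i) + cscale (1 - t) (basis_vec j) else basis_vec p)"
  by (auto simp: shift_map_def cscale_def basis_vec_def fun_eq_iff)

lemma
  assumes "w permutes {1..n}"
  shows rank_set_perm_rank_set: "rank_set (perm_rank_set n w)"
    and card_perm_rank_set: "card (perm_rank_set n w) = n"
proof -
  have eq: "perm_rank_set n w = (\<lambda>i. {w i..i + n}) ` {1..n}"
    by (auto simp: perm_rank_set_def)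
  have w: "w i \<in> {1..n}" if "i \<in> {1..n}" for i
    using permutes_in_image[OF assms, of i] that by simp
  have bounds: "1 \<le> w i" "w i \<le> i + n" if "i \<in> {1..n}" for i
    using w[OF that] by auto
  have Min: "Min {w i..i + n} = w i" and Max: "Max {w i..i + n} = i + n" if "i \<in> {1..n}" for i
    using bounds(2)[OF that] by (auto intro!: Min_eqI Max_eqI)
  have inj: "inj_on (\<lambda>i. {w i..i + n}) {1..n}"
    by (rule inj_on_imageI2[of Max]) (auto simp: inj_on_def Max)
  show "card (perm_rank_set n w) = n"
    unfolding eq using card_image[OF inj] by simp
  have "inj w" using assms by (rule permutes_inj)
  hence "inj_on Min (perm_rank_set n w)" "inj_on Max (perm_rank_set n w)"
    unfolding eq by (auto simp: inj_on_def Min Max dest: injD)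
  thus "rank_set (perm_rank_set n w)"
    unfolding rank_set_def using bounds by (auto simp: eq)
qed

end

theory Submission
  imports Defs
begin

text \<open>
  On the chart of row spaces of \<open>[A | I]\<close>, the flat limit and the diagram variety coincide; since the
  diagram variety is the closure of an affine space in this chart, it is an irreducible component.

  Let \<open>P\<close> be the permutation matrix of \<open>w\<close>. The map \<open>\<phi>\<^bsub>t,w\<^esub>\<close> sends the row space of \<open>[A | I]\<close> to that of
  \<open>[A' | I]\<close> with \<open>t A' = A + (1 - t) P\<close>. If the former lies in the rank variety, then for \<open>(i, j)\<close> in
  the diagram and \<open>K = {k \<le> i. w(k) \<le> w(i)}\<close> the rank condition for the interval \<open>[w(i), n + i]\<close> forces
  the minor of \<open>A = t A' - (1 - t) P\<close> with rows \<open>K\<close> and columns \<open>w(K - {i}) \<union> {j}\<close> to vanish. Its column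
  \<open>j\<close> is divisible by \<open>t\<close>, and after dividing, the minor specialises at \<open>t = 0\<close> to \<open>\<plusminus> A'\<^sub>i\<^sub>j\<close>. Thus the flat
  limit satisfies the equations of the diagram variety. Conversely, every point of the chart of the
  diagram variety is the limit of an explicit polynomial curve \<open>\<phi>\<^bsub>t,w\<^esub> V\<^sub>t\<close>, where \<open>V\<^sub>t\<close> is spanned by vectors
  supported on the intervals \<open>[w(i), n + i]\<close> and is therefore a limit of generic points.
\<close>

section \<open>Polynomial functions and families of forms\<close>

text \<open>A predicate on functions: determinants and values of forms along a curve are then seen
  to be polynomial from the way they are built, without computing coefficients.\<close>

definition univariate_poly :: "(complex \<Rightarrow> complex) \<Rightarrow> bool" where
  "univariate_poly h \<longleftrightarrow> (\<exists>p. \<forall>s. h s = poly p s)"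

lemma univariate_poly_const: "univariate_poly (\<lambda>_. c)"
  unfolding univariate_poly_def by (rule exI[of _ "[:c:]"]) simp

lemma univariate_poly_id: "univariate_poly (\<lambda>s. s)"
  unfolding univariate_poly_def by (rule exI[of _ "[:0, 1:]"]) simp

lemma univariate_poly_add:
  "univariate_poly f \<Longrightarrow> univariate_poly g \<Longrightarrow> univariate_poly (\<lambda>s. f s + g s)"
  unfolding univariate_poly_def by (metis poly_add)

lemma univariate_poly_diff:
  "univariate_poly f \<Longrightarrow> univariate_poly g \<Longrightarrow> univariate_poly (\<lambda>s. f s - g s)"
  unfolding univariate_poly_def by (metis poly_diff)

lemma univariate_poly_mult:
  "univariate_poly f \<Longrightarrow> univariate_poly g \<Longrightarrow> univariate_poly (\<lambda>s. f s * g s)"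
  unfolding univariate_poly_def by (metis poly_mult)

lemma univariate_poly_power: "univariate_poly f \<Longrightarrow> univariate_poly (\<lambda>s. f s ^ N)"
  unfolding univariate_poly_def by (metis poly_power)

lemma univariate_poly_sum:
  "(\<And>i. i \<in> S \<Longrightarrow> univariate_poly (f i)) \<Longrightarrow> univariate_poly (\<lambda>s. \<Sum>i\<in>S. f i s)"
  by (induction S rule: infinite_finite_induct)
     (auto intro: univariate_poly_const univariate_poly_add)

lemma univariate_poly_prod:
  "(\<And>i. i \<in> S \<Longrightarrow> univariate_poly (f i)) \<Longrightarrow> univariate_poly (\<lambda>s. \<Prod>i\<in>S. f i s)"
  by (induction S rule: infinite_finite_induct)
     (auto intro: univariate_poly_const univariate_poly_mult)

lemma univariate_poly_if:
  "univariate_poly f \<Longrightarrow> univariate_poly g \<Longrightarrow> univariate_poly (\<lambda>s. if P then f s else g s)"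
  by (cases P) simp_all

lemmas univariate_poly_intros = univariate_poly_if univariate_poly_const univariate_poly_id univariate_poly_add
  univariate_poly_diff univariate_poly_mult univariate_poly_power univariate_poly_sum
  univariate_poly_prod

text \<open>As a sum of products, the determinant is covered by the closure rules for both
  \<open>univariate_poly\<close> and \<open>family_forms\<close>.\<close>

lemma det_leibniz:
  "det (mat n n f) = (\<Sum>\<pi> | \<pi> permutes {0..<n}. signof \<pi> * (\<Prod>r = 0..<n. f (r, \<pi> r)))"
proof -
  have "(\<Prod>r = 0..<n. mat n n f $$ (r, \<pi> r)) = (\<Prod>r = 0..<n. f (r, \<pi> r))"
    if "\<pi> permutes {0..<n}" for \<pi>
    using permutes_in_image[OF that] by (intro prod.cong) auto
  thus ?thesis by (simp add: det_def'[of _ n])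
qed

lemma univariate_poly_det:
  assumes "\<And>r c. r < n \<Longrightarrow> c < n \<Longrightarrow> univariate_poly (f r c)"
  shows "univariate_poly (\<lambda>s. det (mat n n (\<lambda>(r, c). f r c s)))"
  unfolding det_leibniz split
  by (intro univariate_poly_intros assms) (auto dest: permutes_in_image)

lemma univariate_poly_poly_funs:
  assumes "f \<in> poly_funs X" "\<And>x. x \<in> X \<Longrightarrow> univariate_poly (\<lambda>s. p s x)"
  shows "univariate_poly (\<lambda>s. f (p s))"
  using assms by (induction rule: poly_funs.induct) (auto intro: univariate_poly_intros)

text \<open>The product of the two polynomials vanishes at every point, so it is zero, and there are
  no zero divisors. Passages to the limit along lines and curves are made with this identity
  principle.\<close>

lemma univariate_poly_eq_0:
  assumes "univariate_poly g" "univariate_poly h" "\<And>s. g s \<noteq> 0 \<Longrightarrow> h s = 0" "g s\<^sub>0 \<noteq> 0"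
  shows "h s = 0"
proof -
  obtain p q where pq: "\<And>s. g s = poly p s" "\<And>s. h s = poly q s"
    using assms(1,2) unfolding univariate_poly_def by blast
  have "poly (p * q) s = 0" for s
    using assms(3)[of s] pq by auto
  hence "p * q = 0" using poly_all_0_iff_0 by blast
  moreover have "p \<noteq> 0" using assms(4) pq(1) by auto
  ultimately show ?thesis using pq(2) by simp
qed

section \<open>Forms in the Pluecker coordinates and their polynomial families\<close>

lemma zero_form: "(\<lambda>_. 0) \<in> forms k m d"
  by (auto simp: forms_def intro: poly_funs.const)

lemma forms_add: "f \<in> forms k m d \<Longrightarrow> g \<in> forms k m d \<Longrightarrow> (\<lambda>p. f p + g p) \<in> forms k m d"
  by (auto simp: forms_def algebra_simps intro: poly_funs.add)

lemma forms_sum: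
  "(\<And>i. i \<in> S \<Longrightarrow> f i \<in> forms k m d) \<Longrightarrow> (\<lambda>p. \<Sum>i\<in>S. f i p) \<in> forms k m d"
  by (induction S rule: infinite_finite_induct) (auto intro: zero_form forms_add)

lemma forms_cmult: "f \<in> forms k m d \<Longrightarrow> (\<lambda>p. c * f p) \<in> forms k m d"
  using forms_mult[OF forms_const] by fastforce

lemma forms_var: "I \<subseteq> {1..m} \<Longrightarrow> card I = k \<Longrightarrow> (\<lambda>p. p I) \<in> forms k m 1"
  by (auto simp: forms_def intro: poly_funs.var)

lemma family_forms_specialise: "f \<in> family_forms k m d \<Longrightarrow> f t \<in> forms k m d"
  by (auto simp: family_forms_def intro!: forms_sum forms_cmult)

lemma family_forms_add:
  assumes "f \<in> family_forms k m d" "g \<in> family_forms k m d"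
  shows "(\<lambda>t p. f t p + g t p) \<in> family_forms k m d"
proof -
  obtain N F where F: "\<And>i. i \<le> N \<Longrightarrow> F i \<in> forms k m d" "f = (\<lambda>t p. \<Sum>i\<le>N. t ^ i * F i p)"
    using assms(1) by (auto simp: family_forms_def)
  obtain L H where H: "\<And>i. i \<le> L \<Longrightarrow> H i \<in> forms k m d" "g = (\<lambda>t p. \<Sum>i\<le>L. t ^ i * H i p)"
    using assms(2) by (auto simp: family_forms_def)
  \<comment> \<open>Padding with zero forms brings both sums to the common length
    \<open>max N L\<close>.\<close>
  let ?F = "\<lambda>i p. if i \<le> N then F i p else 0" and ?H = "\<lambda>i p. if i \<le> L then H i p else 0"
  have "?F i \<in> forms k m d" "?H i \<in> forms k m d" for i
    by (cases "i \<le> N"; simp add: F zero_form) (cases "i \<le> L"; simp add: H zero_form)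
  hence "\<forall>i \<le> max N L. (\<lambda>p. ?F i p + ?H i p) \<in> forms k m d"
    by (intro allI impI forms_add)
  moreover have "f t p + g t p = (\<Sum>i\<le>max N L. t ^ i * (?F i p + ?H i p))" for t p
  proof -
    have "f t p = (\<Sum>i\<le>max N L. t ^ i * ?F i p)"
      unfolding F(2) by (rule sum.mono_neutral_cong_left) auto
    moreover have "g t p = (\<Sum>i\<le>max N L. t ^ i * ?H i p)"
      unfolding H(2) by (rule sum.mono_neutral_cong_left) auto
    ultimately show ?thesis by (simp add: sum.distrib ring_distribs)
  qed
  ultimately show ?thesis unfolding family_forms_def
    by (intro CollectI exI[of _ "max N L"] exI[of _ "\<lambda>i p. ?F i p + ?H i p"]) auto
qed

lemma family_forms_monomial:
  assumes "g \<in> forms k m d"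
  shows "(\<lambda>t p. t ^ N * g p) \<in> family_forms k m d"
proof -
  have "t ^ N * g p = (\<Sum>i\<le>N. t ^ i * (if i = N then g p else 0))" for t p
    by (simp add: if_distrib[of "(*) _"] cong: if_cong)
  moreover have "\<forall>i\<le>N. (\<lambda>p. if i = N then g p else 0) \<in> forms k m d"
  proof (intro allI impI)
    fix i show "(\<lambda>p. if i = N then g p else 0) \<in> forms k m d"
      by (cases "i = N") (simp_all add: assms zero_form)
  qed
  ultimately show ?thesis unfolding family_forms_def
    by (intro CollectI exI[of _ N] exI[of _ "\<lambda>i p. if i = N then g p else 0"]) auto
qed

lemma family_forms_const: "g \<in> forms k m d \<Longrightarrow> (\<lambda>t. g) \<in> family_forms k m d"
  using family_forms_monomial[of g k m d 0] by simp

lemma family_forms_sum: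
  "(\<And>i. i \<in> S \<Longrightarrow> f i \<in> family_forms k m d) \<Longrightarrow> (\<lambda>t p. \<Sum>i\<in>S. f i t p) \<in> family_forms k m d"
  by (induction S rule: infinite_finite_induct)
     (auto intro: family_forms_const zero_form family_forms_add)

lemma family_forms_mult:
  assumes "f \<in> family_forms k m d" "g \<in> family_forms k m d'"
  shows "(\<lambda>t p. f t p * g t p) \<in> family_forms k m (d + d')"
proof -
  obtain N F where F: "\<And>i. i \<le> N \<Longrightarrow> F i \<in> forms k m d" "f = (\<lambda>t p. \<Sum>i\<le>N. t ^ i * F i p)"
    using assms(1) by (auto simp: family_forms_def)
  obtain L H where H: "\<And>i. i \<le> L \<Longrightarrow> H i \<in> forms k m d'" "g = (\<lambda>t p. \<Sum>i\<le>L. t ^ i * H i p)"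
    using assms(2) by (auto simp: family_forms_def)
  have "(\<lambda>t p. f t p * g t p) = (\<lambda>t p. \<Sum>i\<le>N. \<Sum>j\<le>L. t ^ (i + j) * (F i p * H j p))"
    unfolding F(2) H(2) by (simp add: sum_product power_add mult_ac)
  also have "\<dots> \<in> family_forms k m (d + d')"
    by (intro family_forms_sum family_forms_monomial forms_mult F H) auto
  finally show ?thesis .
qed

lemma family_forms_prod:
  assumes "finite S" "\<And>i. i \<in> S \<Longrightarrow> f i \<in> family_forms k m 1"
  shows "(\<lambda>t p. \<Prod>i\<in>S. f i t p) \<in> family_forms k m (card S)"
  using assms
proof (induction rule: finite_induct)
  case empty
  show ?case using family_forms_const[OF forms_const[of 1]] by simp
next
  case (insert x S)
  thus ?case using family_forms_mult[of "f x" k m 1 _ "card S"] by simp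
qed

lemma family_forms_det:
  assumes "\<And>r c. r < n \<Longrightarrow> c < n \<Longrightarrow> f r c \<in> family_forms k m 1"
  shows "(\<lambda>t p. det (mat n n (\<lambda>(r, c). f r c t p))) \<in> family_forms k m n"
proof -
  have "(\<lambda>t p. \<Prod>r = 0..<n. f r (\<pi> r) t p) \<in> family_forms k m n" if "\<pi> permutes {0..<n}" for \<pi>
    using family_forms_prod[of "{0..<n}" "\<lambda>r. f r (\<pi> r)"] assms permutes_in_image[OF that] by auto
  hence "(\<lambda>t p. signof \<pi> * (\<Prod>r = 0..<n. f r (\<pi> r) t p)) \<in> family_forms k m n"
    if "\<pi> permutes {0..<n}" for \<pi>
    using that family_forms_mult[OF family_forms_const[OF forms_const[of "signof \<pi>"]]] by fastforce
  thus ?thesis unfolding det_leibniz split by (intro family_forms_sum) auto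
qed

lemma univariate_poly_family_forms:
  assumes "f \<in> family_forms k m d"
    "\<And>I. I \<subseteq> {1..m} \<Longrightarrow> card I = k \<Longrightarrow> univariate_poly (\<lambda>t. p t I)"
  shows "univariate_poly (\<lambda>t. f t (p t))"
proof -
  obtain N F where F: "\<And>i. i \<le> N \<Longrightarrow> F i \<in> forms k m d" "f = (\<lambda>t p. \<Sum>i\<le>N. t ^ i * F i p)"
    using assms(1) by (auto simp: family_forms_def)
  have "univariate_poly (\<lambda>t. F i (p t))" if "i \<le> N" for i
    using F(1)[OF that] assms(2) unfolding forms_def
    by (intro univariate_poly_poly_funs[where f = "F i"]) auto
  thus ?thesis unfolding F(2) by (intro univariate_poly_intros) auto
qed

lemma univariate_poly_pluecker:
  assumes "\<And>i x. i \<in> {1..k} \<Longrightarrow> univariate_poly (\<lambda>s. b s i x)"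
  shows "univariate_poly (\<lambda>s. pluecker k (b s) I)"
  unfolding pluecker_def
  by (rule univariate_poly_det[of k "\<lambda>r c s. b s (Suc r) (sorted_list_of_set I ! c)"])
     (auto intro: assms)


section \<open>Linear algebra\<close>

lemma sum_fun_apply: "(\<Sum>i\<in>S. f i) x = (\<Sum>i\<in>S. f i x)"
  for f :: "'a \<Rightarrow> 'b \<Rightarrow> 'c :: comm_monoid_add"
  by (induction S rule: infinite_finite_induct) auto

lemma span_family_iff:
  assumes "finite J"
  shows "y \<in> cv.span (b ` J) \<longleftrightarrow> (\<exists>x. \<forall>j. y j = (\<Sum>i\<in>J. x i * b i j))"
proof
  assume "y \<in> cv.span (b ` J)"
  thus "\<exists>x. \<forall>j. y j = (\<Sum>i\<in>J. x i * b i j)"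
  proof (induction rule: cv.span_induct_alt)
    case base
    show ?case by (rule exI[of _ "\<lambda>_. 0"]) auto
  next
    case (step c u v)
    then obtain x i where x: "\<And>j. v j = (\<Sum>i\<in>J. x i * b i j)" and i: "i \<in> J" "u = b i" by blast
    have "(cscale c u + v) j = (\<Sum>l\<in>J. (x l + (if l = i then c else 0)) * b l j)" for j
    proof -
      have "(\<Sum>l\<in>J. (x l + (if l = i then c else 0)) * b l j) =
            (\<Sum>l\<in>J. x l * b l j) + (\<Sum>l\<in>J. if l = i then c * b l j else 0)"
        by (subst sum.distrib[symmetric], rule sum.cong) (auto simp: algebra_simps)
      thus ?thesis using assms i by (simp add: x cscale_def)
    qed
    thus ?case by (intro exI[of _ "\<lambda>l. x l + (if l = i then c else 0)"]) blast
  qed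
next
  assume "\<exists>x. \<forall>j. y j = (\<Sum>i\<in>J. x i * b i j)"
  then obtain x where "y = (\<Sum>i\<in>J. cscale (x i) (b i))"
    by (auto simp: fun_eq_iff sum_fun_apply cscale_def)
  thus "y \<in> cv.span (b ` J)"
    by (simp add: cv.span_sum cv.span_scale cv.span_base)
qed

lemma coord_span_eq:
  assumes "finite X"
  shows "coord_span X = {v. \<forall>x. x \<notin> X \<longrightarrow> v x = 0}"
proof -
  have sum: "(\<Sum>i\<in>X. a i * basis_vec i j) = (if j \<in> X then a j else 0)" for a j
    using assms by (simp add: basis_vec_def if_distrib[of "(*) _"] cong: if_cong)
  have "v \<in> coord_span X \<longleftrightarrow> (\<forall>x. x \<notin> X \<longrightarrow> v x = 0)" for v
    unfolding coord_span_def span_family_iff[OF assms] sum by metis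
  thus ?thesis by blast
qed

lemma subspace_coord_span: "cv.subspace (coord_span X)"
  by (simp add: coord_span_def)

definition independent_family :: "nat set \<Rightarrow> (nat \<Rightarrow> nat \<Rightarrow> complex) \<Rightarrow> bool" where
  "independent_family J b \<longleftrightarrow>
     (\<forall>x. (\<forall>j. (\<Sum>i\<in>J. x i * b i j) = 0) \<longrightarrow> (\<forall>i\<in>J. x i = 0))"

lemma independent_familyD:
  "independent_family J b \<Longrightarrow> (\<And>j. (\<Sum>i\<in>J. x i * b i j) = 0) \<Longrightarrow> i \<in> J \<Longrightarrow> x i = 0"
  unfolding independent_family_def by (drule spec[of _ x]) simp

lemma independent_family_subset:
  assumes "independent_family J b" "finite J" "I \<subseteq> J"
  shows "independent_family I b"
  unfolding independent_family_def
proof (intro allI impI ballI)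
  fix x i
  assume x: "\<forall>j. (\<Sum>i\<in>I. x i * b i j) = 0" and i: "i \<in> I"
  have "(\<Sum>i\<in>J. (if i \<in> I then x i else 0) * b i j) = (\<Sum>i\<in>I. x i * b i j)" for j
    using assms by (intro sum.mono_neutral_cong_right) auto
  hence "(if i \<in> I then x i else 0) = 0"
    using x i assms(3)
    by (intro independent_familyD[OF assms(1), where x = "\<lambda>i. if i \<in> I then x i else 0"]) auto
  thus "x i = 0" using i by simp
qed

lemma dim_span_independent_family:
  assumes "independent_family J b" "finite J"
  shows "cv.dim (cv.span (b ` J)) = card J"
proof -
  have inj: "inj_on b J"
  proof (rule inj_onI, rule ccontr)
    fix i k assume ik: "i \<in> J" "k \<in> J" "b i = b k" "i \<noteq> k"
    \<comment> \<open>Two equal members satisfy the relation with coefficient 1 at \<open>i\<close>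
      and -1 at \<open>k\<close>.\<close>
    let ?x = "\<lambda>l. (if l = i then 1 else 0) - (if l = k then 1 else 0 :: complex)"
    have "(\<Sum>l\<in>J. ?x l * b l j) = 0" for j
    proof -
      have "(\<Sum>l\<in>J. ?x l * b l j) =
            (\<Sum>l\<in>J. if l = i then b l j else 0) - (\<Sum>l\<in>J. if l = k then b l j else 0)"
        by (subst sum_subtractf[symmetric], rule sum.cong) auto
      thus ?thesis using ik(1-3) assms(2) by simp
    qed
    hence "?x i = 0" by (rule independent_familyD[OF assms(1) _ ik(1)])
    thus False using ik(4) by simp
  qed
  have "\<not> cv.dependent (b ` J)"
  proof
    assume "cv.dependent (b ` J)"
    then obtain u v where u: "v \<in> b ` J" "u v \<noteq> 0" "(\<Sum>v\<in>b ` J. cscale (u v) v) = 0"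
      using cv.dependent_finite[of "b ` J"] assms(2) by auto
    have "(\<Sum>i\<in>J. cscale (u (b i)) (b i)) = 0"
      using u(3) by (simp add: sum.reindex[OF inj])
    hence "(\<Sum>i\<in>J. u (b i) * b i j) = 0" for j
      by (simp add: fun_eq_iff sum_fun_apply cscale_def)
    hence "u (b i) = 0" if "i \<in> J" for i
      using that by (rule independent_familyD[OF assms(1), where x = "\<lambda>i. u (b i)"])
    thus False using u(1,2) by auto
  qed
  hence "cv.dim (cv.span (b ` J)) = card (b ` J)" by (rule cv.dim_span_eq_card_independent)
  thus ?thesis by (simp only: card_image[OF inj])
qed

text \<open>Sorting the columns costs the sign of a permutation. The sign depends on
  \<open>cs\<close> only, not on \<open>b\<close>, so an unsorted minor is still a linear form in
  the Pluecker coordinates.\<close>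

lemma det_columns_eq_pluecker:
  assumes inj: "inj_on cs {..<k}"
  shows "\<exists>s. \<forall>b. det (mat k k (\<lambda>(r, c). b (Suc r) (cs c))) = s * pluecker k b (cs ` {..<k})"
proof -
  define L where "L = sorted_list_of_set (cs ` {..<k})"
  have L: "length L = k" "set L = cs ` {..<k}" "distinct L"
    using inj by (auto simp: L_def card_image)
  have "\<exists>i<k. L ! i = cs c" if "c < k" for c
  proof -
    have "cs c \<in> set L" using L(2) that by blast
    thus ?thesis unfolding in_set_conv_nth L(1) .
  qed
  then obtain \<rho> where \<rho>: "\<And>c. c < k \<Longrightarrow> \<rho> c < k" "\<And>c. c < k \<Longrightarrow> L ! \<rho> c = cs c" by metis
  define \<pi> where "\<pi> c = (if c < k then \<rho> c else c)" for c
  have "inj_on \<pi> {0..<k}"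
  proof (rule inj_onI)
    fix c d assume cd: "c \<in> {0..<k}" "d \<in> {0..<k}" "\<pi> c = \<pi> d"
    hence "cs c = cs d" using \<rho>(2)[of c] \<rho>(2)[of d] by (simp add: \<pi>_def)
    thus "c = d" using cd inj by (auto dest: inj_onD)
  qed
  moreover have "\<pi> ` {0..<k} \<subseteq> {0..<k}" using \<rho> by (auto simp: \<pi>_def)
  ultimately have "bij_betw \<pi> {0..<k} {0..<k}"
    by (simp add: bij_betw_def endo_inj_surj)
  hence \<pi>: "\<pi> permutes {0..<k}" by (rule bij_imp_permutes) (auto simp: \<pi>_def)
  have "det (mat k k (\<lambda>(r, c). b (Suc r) (cs c))) = signof \<pi> * pluecker k b (cs ` {..<k})" for b
  proof -
    let ?M = "mat k k (\<lambda>(r, c). b (Suc r) (L ! c))"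
    have "det (mat k k (\<lambda>(r, c). b (Suc r) (cs c))) =
          det (transpose_mat (mat k k (\<lambda>(r, c). b (Suc r) (cs c))))"
      by (rule det_transpose[of _ k, symmetric]) simp
    \<comment> \<open>Reordering the columns of \<open>?M\<close> means permuting the rows of its
      transpose.\<close>
    also have "transpose_mat (mat k k (\<lambda>(r, c). b (Suc r) (cs c))) =
               mat k k (\<lambda>(r, c). transpose_mat ?M $$ (\<pi> r, c))"
      using \<rho> by (intro eq_matI) (auto simp: \<pi>_def)
    also have "det \<dots> = signof \<pi> * det (transpose_mat ?M)"
      by (rule det_permute_rows[OF _ \<pi>]) simp
    also have "det (transpose_mat ?M) = det ?M" by (rule det_transpose[of _ k]) simp
    finally show ?thesis by (simp add: pluecker_def L_def)
  qed
  thus ?thesis by blast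
qed

lemma pluecker_scale: "pluecker k (\<lambda>i. cscale c (b i)) I = c ^ k * pluecker k b I"
proof -
  have "mat k k (\<lambda>(r, j). cscale c (b (Suc r)) (sorted_list_of_set I ! j)) =
        c \<cdot>\<^sub>m mat k k (\<lambda>(r, j). b (Suc r) (sorted_list_of_set I ! j))"
    by (rule eq_matI) (auto simp: cscale_def)
  thus ?thesis by (simp add: pluecker_def)
qed

lemma pluecker_cong:
  assumes "\<And>i. i \<in> {1..k} \<Longrightarrow> b i = b' i"
  shows "pluecker k b = pluecker k b'"
  unfolding pluecker_def fun_eq_iff
  by (intro allI arg_cong[where f = det] cong_mat) (auto simp: assms)

lemma sorted_list_of_right_half: "c < n \<Longrightarrow> sorted_list_of_set {n + 1..2 * n} ! c = n + Suc c"
proof -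
  have "sorted_list_of_set {n + 1..2 * n} = [n + 1..<2 * n + 1]"
    by (metis Suc_eq_plus1 atLeastLessThanSuc_atLeastAtMost sorted_list_of_set_range)
  thus "c < n \<Longrightarrow> ?thesis" by (simp del: upt_Suc)
qed

lemma pluecker_right_half:
  "pluecker n b {n + 1..2 * n} = det (mat n n (\<lambda>(r, c). b (Suc r) (n + Suc c)))"
  unfolding pluecker_def
  by (intro arg_cong[where f = det] cong_mat) (auto simp: sorted_list_of_right_half[simplified])

text \<open>Relations between rows are what spanning families provide; the vanishing or
  non-vanishing of a minor is translated into such relations in all rank arguments below.\<close>

lemma det_eq_0_iff_left_kernel:
  fixes f :: "nat \<Rightarrow> nat \<Rightarrow> complex"
  shows "det (mat n n (\<lambda>(r, c). f (Suc r) (Suc c))) = 0 \<longleftrightarrow>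
    (\<exists>x. (\<exists>i\<in>{1..n}. x i \<noteq> 0) \<and> (\<forall>c\<in>{1..n}. (\<Sum>i = 1..n. x i * f i c) = 0))"
    (is "det ?M = 0 \<longleftrightarrow> ?R")
proof -
  have Suc_sum: "(\<Sum>i = Suc 0..n. g i) = (\<Sum>r = 0..<n. g (Suc r))" for g :: "nat \<Rightarrow> complex"
    by (simp add: sum.atLeast1_atMost_eq lessThan_atLeast0)
  have "det ?M = 0 \<longleftrightarrow> det (transpose_mat ?M) = 0"
    by (simp add: det_transpose[of _ n])
  also have "\<dots> \<longleftrightarrow> (\<exists>v. v \<in> carrier_vec n \<and> v \<noteq> 0\<^sub>v n \<and> transpose_mat ?M *\<^sub>v v = 0\<^sub>v n)"
    by (rule det_0_iff_vec_prod_zero) simp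
  also have "\<dots> \<longleftrightarrow> ?R"
  proof
    assume "\<exists>v. v \<in> carrier_vec n \<and> v \<noteq> 0\<^sub>v n \<and> transpose_mat ?M *\<^sub>v v = 0\<^sub>v n"
    then obtain v where v: "v \<in> carrier_vec n" "v \<noteq> 0\<^sub>v n" "transpose_mat ?M *\<^sub>v v = 0\<^sub>v n" by blast
    have "\<exists>r<n. v $ r \<noteq> 0"
    proof (rule ccontr)
      assume "\<not> (\<exists>r<n. v $ r \<noteq> 0)"
      hence "v = 0\<^sub>v n" using v(1) by (intro eq_vecI) auto
      thus False using v(2) by contradiction
    qed
    then obtain r where r: "r < n" "v $ r \<noteq> 0" by blast
    have "(\<Sum>i = 1..n. v $ (i - 1) * f i c) = 0" if c: "c \<in> {1..n}" for c
    proof -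
      obtain c' where c': "c = Suc c'" "c' < n" using c by (cases c) auto
      have "(transpose_mat ?M *\<^sub>v v) $ c' = 0" using v(3) c' by simp
      thus ?thesis using c' v(1) by (simp add: Suc_sum scalar_prod_def mult.commute)
    qed
    thus ?R using r by (intro exI[of _ "\<lambda>i. v $ (i - 1)"]) (auto intro!: bexI[of _ "Suc r"])
  next
    assume ?R
    then obtain x i where x: "i \<in> {1..n}" "x i \<noteq> 0" "\<And>c. c \<in> {1..n} \<Longrightarrow> (\<Sum>i = 1..n. x i * f i c) = 0"
      by blast
    let ?v = "vec n (\<lambda>r. x (Suc r))"
    have "?v $ (i - 1) \<noteq> 0\<^sub>v n $ (i - 1)" using x(1,2) by auto
    hence "?v \<noteq> 0\<^sub>v n" by (rule contrapos_nn) (rule arg_cong)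
    moreover have "transpose_mat ?M *\<^sub>v ?v = 0\<^sub>v n"
    proof (rule eq_vecI)
      fix c assume "c < dim_vec (0\<^sub>v n :: complex vec)"
      thus "(transpose_mat ?M *\<^sub>v ?v) $ c = 0\<^sub>v n $ c"
        using x(3)[of "Suc c"] by (simp add: scalar_prod_def Suc_sum mult.commute)
    qed simp
    ultimately show "\<exists>v. v \<in> carrier_vec n \<and> v \<noteq> 0\<^sub>v n \<and> transpose_mat ?M *\<^sub>v v = 0\<^sub>v n"
      by (intro exI[of _ ?v]) auto
  qed
  finally show ?thesis .
qed


section \<open>The chart of row spaces and the maps \<open>\<phi>\<^bsub>t,w\<^esub>\<close>\<close>

definition aug_row :: "nat \<Rightarrow> (nat \<Rightarrow> nat \<Rightarrow> complex) \<Rightarrow> nat \<Rightarrow> nat \<Rightarrow> complex" where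
  "aug_row n A i = (\<lambda>j. if j \<in> {1..n} then A i j else if j = n + i then 1 else 0)"

lemma rowspan_aug_eq_span: "rowspan_aug n (2 * n) A = cv.span (aug_row n A ` {1..n})"
proof -
  have "2 * n - n = n" by simp
  thus ?thesis unfolding rowspan_aug_def aug_row_def by (simp only:)
qed

lemma sum_aug_row:
  assumes "k \<in> {1..n}"
  shows "(\<Sum>i = 1..n. x i * aug_row n A i (n + k)) = x k"
proof -
  have "(\<Sum>i = 1..n. x i * aug_row n A i (n + k)) = (\<Sum>i = 1..n. if i = k then x i else 0)"
    using assms by (intro sum.cong) (auto simp: aug_row_def)
  thus ?thesis using assms by simp
qed

lemma independent_aug_row: "independent_family {1..n} (aug_row n A)"
  unfolding independent_family_def
proof (intro allI impI ballI)
  fix x k assume "\<forall>j. (\<Sum>i = 1..n. x i * aug_row n A i j) = 0" "k \<in> {1..n}"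
  thus "x k = 0" using sum_aug_row[of k n x A] by simp
qed

lemma rowspan_aug_in_Gr: "rowspan_aug n (2 * n) A \<in> Gr n (2 * n)"
proof -
  have "aug_row n A i \<in> coord_span {1..2 * n}" if "i \<in> {1..n}" for i
    using that by (auto simp: coord_span_eq aug_row_def)
  hence "cv.span (aug_row n A ` {1..n}) \<subseteq> coord_span {1..2 * n}"
    by (intro cv.span_minimal subspace_coord_span) blast
  moreover have "cv.dim (cv.span (aug_row n A ` {1..n})) = n"
    using dim_span_independent_family[OF independent_aug_row] by simp
  ultimately show ?thesis by (simp only: Gr_def rowspan_aug_eq_span mem_Collect_eq cv.subspace_span simp_thms)
qed

lemma right_half_form: "(\<lambda>p. p {n + 1..2 * n}) \<in> forms n (2 * n) 1"
  by (rule forms_var) auto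

lemma pluecker_aug_row_right_half: "pluecker n (aug_row n A) {n + 1..2 * n} = 1"
proof -
  have "mat n n (\<lambda>(r, c). aug_row n A (Suc r) (n + Suc c)) = 1\<^sub>m n"
    by (rule eq_matI) (auto simp: aug_row_def)
  thus ?thesis by (simp only: pluecker_right_half det_one)
qed

text \<open>Replacing column \<open>k\<close> of the identity block by column \<open>j\<close> of
  \<open>A\<close> gives a minor equal to \<open>A k j\<close> by Cramer's rule; sorting its columns
  contributes the constant \<open>s\<close>.\<close>

lemma matrix_entry_form:
  assumes "k \<in> {1..n}" "j \<in> {1..n}"
  shows "\<exists>q \<in> forms n (2 * n) 1. \<forall>A. q (pluecker n (aug_row n A)) = A k j"
proof -
  define cs where "cs c = (if Suc c = k then j else n + Suc c)" for c
  have inj: "inj_on cs {..<n}"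
    using assms by (auto simp: inj_on_def cs_def split: if_splits)
  then obtain s where s: "\<And>b. det (mat n n (\<lambda>(r, c). b (Suc r) (cs c))) = s * pluecker n b (cs ` {..<n})"
    using det_columns_eq_pluecker by blast
  have "(\<lambda>p. s * p (cs ` {..<n})) \<in> forms n (2 * n) 1"
    using assms card_image[OF inj] by (intro forms_cmult forms_var) (auto simp: cs_def[abs_def])
  moreover have "s * pluecker n (aug_row n A) (cs ` {..<n}) = A k j" for A
  proof -
    let ?v = "vec n (\<lambda>r. A (Suc r) j)"
    have "mat n n (\<lambda>(r, c). aug_row n A (Suc r) (cs c)) = replace_col (1\<^sub>m n) (1\<^sub>m n *\<^sub>v ?v) (k - 1)"
      using assms by (intro eq_matI) (auto simp: aug_row_def cs_def replace_col_def)
    hence "det (mat n n (\<lambda>(r, c). aug_row n A (Suc r) (cs c))) = ?v $ (k - 1) * det (1\<^sub>m n)"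
      using assms by (simp only:) (rule cramer_lemma_mat, auto)
    moreover have "?v $ (k - 1) = A k j" using assms by (cases k) auto
    ultimately show ?thesis by (simp add: s)
  qed
  ultimately show ?thesis by (intro bexI[of _ "\<lambda>p. s * p (cs ` {..<n})"]) auto
qed

text \<open>Multiplying the basis by the inverse \<open>Y\<close> of its right half
  \<open>?B\<close> turns that half into the identity. \<open>Y * ?B\<close> gives the shape of the
  new rows \<open>a\<close>, and \<open>?B * Y\<close> shows that they still span
  \<open>V\<close>.\<close>

lemma Gr_right_half_chart:
  assumes V: "V \<in> Gr n (2 * n)" and b: "cv.span (b ` {1..n}) = V"
    and nz: "pluecker n b {n + 1..2 * n} \<noteq> 0"
  obtains A where "V = rowspan_aug n (2 * n) A"
proof -
  let ?B = "mat n n (\<lambda>(r, c). b (Suc r) (n + Suc c))"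
  have "?B \<in> Units (ring_mat TYPE(complex) n ())"
    using nz by (intro det_non_zero_imp_unit) (auto simp only: pluecker_right_half mat_carrier)
  then obtain Y where Y: "Y \<in> carrier_mat n n" "Y * ?B = 1\<^sub>m n" "?B * Y = 1\<^sub>m n"
    unfolding Units_def ring_mat_def by auto
  define y where "y l r = Y $$ (l - 1, r - 1)" for l r
  have Suc_sum: "(\<Sum>i = Suc 0..n. g i) = (\<Sum>r = 0..<n. g (Suc r))" for g :: "nat \<Rightarrow> complex"
    by (simp add: sum.atLeast1_atMost_eq lessThan_atLeast0)
  have yb: "(\<Sum>r = 1..n. y l r * b r (n + k)) = (if l = k then 1 else 0)"
    if l: "l \<in> {1..n}" and k: "k \<in> {1..n}" for l k
  proof -
    obtain l' k' where lk: "l = Suc l'" "l' < n" "k = Suc k'" "k' < n"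
      using l k by (cases l; cases k) auto
    have "(Y * ?B) $$ (l', k') = (if l = k then 1 else 0)"
      unfolding Y(2) using lk by simp
    thus ?thesis using lk Y(1) by (simp add: scalar_prod_def Suc_sum y_def)
  qed
  have b_y: "(\<Sum>l = 1..n. b r (n + l) * y l s) = (if r = s then 1 else 0)"
    if r: "r \<in> {1..n}" and s: "s \<in> {1..n}" for r s
  proof -
    obtain r' s' where rs: "r = Suc r'" "r' < n" "s = Suc s'" "s' < n"
      using r s by (cases r; cases s) auto
    have "(?B * Y) $$ (r', s') = (if r = s then 1 else 0)"
      unfolding Y(3) using rs by simp
    thus ?thesis using rs Y(1) by (simp add: scalar_prod_def Suc_sum y_def)
  qed
  define a where "a l j = (\<Sum>r = 1..n. y l r * b r j)" for l j
  \<comment> \<open>\<open>aug_row\<close> is zero at every index beyond \<open>2 * n\<close>, so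
    the new rows have to be as well.\<close>
  have b0: "b r j = 0" if "r \<in> {1..n}" "j \<notin> {1..2 * n}" for r j
  proof -
    have "b r \<in> V" unfolding b[symmetric] by (rule cv.span_base) (use that in blast)
    thus ?thesis using V that by (auto simp: Gr_def coord_span_eq)
  qed
  have a: "aug_row n a l = a l" if l: "l \<in> {1..n}" for l
  proof
    fix j
    consider "j \<in> {1..n}" | k where "k \<in> {1..n}" "j = n + k" | "j \<notin> {1..2 * n}"
    proof -
      have "j \<in> {1..n} \<or> j \<notin> {1..2 * n} \<or> j - n \<in> {1..n} \<and> j = n + (j - n)" by auto
      thus thesis using that by blast
    qed
    thus "aug_row n a l j = a l j"
    proof cases
      case 3
      hence "a l j = 0" using b0 by (simp add: a_def)
      thus ?thesis using 3 l by (auto simp: aug_row_def)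
    qed (use l yb[OF l] in \<open>auto simp: aug_row_def a_def\<close>)
  qed
  have "aug_row n a ` {1..n} = a ` {1..n}" using a by auto
  moreover have "a l \<in> V" if "l \<in> {1..n}" for l
    unfolding b[symmetric] span_family_iff[OF finite_atLeastAtMost] a_def
    by (intro exI[of _ "y l"] allI refl)
  moreover have "b r \<in> cv.span (a ` {1..n})" if r: "r \<in> {1..n}" for r
  proof -
    have "b r j = (\<Sum>l = 1..n. b r (n + l) * a l j)" for j
    proof -
      have "(\<Sum>l = 1..n. b r (n + l) * a l j) = (\<Sum>s = 1..n. (\<Sum>l = 1..n. b r (n + l) * y l s) * b s j)"
        unfolding a_def sum_distrib_left sum_distrib_right
        by (subst sum.swap) (simp add: mult.assoc)
      also have "\<dots> = (\<Sum>s = 1..n. if s = r then b s j else 0)"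
        using b_y[OF r] by (intro sum.cong) auto
      finally show ?thesis using r by simp
    qed
    thus ?thesis unfolding span_family_iff[OF finite_atLeastAtMost]
      by (intro exI[of _ "\<lambda>l. b r (n + l)"] allI)
  qed
  ultimately have "cv.span (aug_row n a ` {1..n}) = V"
    unfolding b[symmetric] cv.span_eq by auto
  thus ?thesis using that[of a] by (simp only: rowspan_aug_eq_span)
qed

text \<open>The factors do not interfere: each reads a coordinate of the right half and adds to a
  coordinate of the left half, and distinct factors have distinct sources and distinct
  targets.\<close>

lemma perm_shift_map_apply:
  assumes "w permutes {1..n}"
  shows "perm_shift_map n t w v =
    (\<lambda>x. if x \<in> {1..n} then v x + (1 - t) * v (n + inv_into UNIV w x)
         else if x \<in> {n + 1..2 * n} then t * v x else v x)"
proof -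
  have w: "w i \<in> {1..n}" if "i \<in> {1..n}" for i
    using permutes_in_image[OF assms, of i] that by simp
  have winj: "w i = w j \<longleftrightarrow> i = j" for i j
    using permutes_inj[OF assms] by (auto dest: injD)
  have inv_w: "inv_into UNIV w (w i) = i" for i using permutes_inverses[OF assms] by simp
  have shift: "shift_map t i j u x = (if x = i then 0 else u x) +
      u i * ((if x = i then t else 0) + (if x = j then 1 - t else 0))" for i j u x
    by (simp add: shift_map_def cscale_def basis_vec_def)
  \<comment> \<open>The induction runs over partial compositions, indexed by duplicate-free
    lists.\<close>
  have fold: "foldr (\<circ>) (map (\<lambda>i. shift_map t (n + i) (w i)) xs) id v =
      (\<lambda>x. if x \<in> w ` set xs then v x + (1 - t) * v (n + inv_into UNIV w x)
           else if x \<in> (+) n ` set xs then t * v x else v x)"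
    if "distinct xs" "set xs \<subseteq> {1..n}" for xs
    using that
  proof (induction xs)
    case (Cons a xs)
    define u where "u = foldr (\<circ>) (map (\<lambda>i. shift_map t (n + i) (w i)) xs) id v"
    have IH: "u = (\<lambda>x. if x \<in> w ` set xs then v x + (1 - t) * v (n + inv_into UNIV w x)
           else if x \<in> (+) n ` set xs then t * v x else v x)"
      unfolding u_def by (rule Cons.IH) (use Cons.prems in auto)
    have a: "a \<in> {1..n}" "a \<notin> set xs" and xs: "\<And>i. i \<in> set xs \<Longrightarrow> i \<in> {1..n}"
      using Cons.prems by auto
    have na: "n + a \<notin> w ` set xs" using w[OF xs] a(1) by fastforce
    hence u_na: "u (n + a) = v (n + a)" unfolding IH using a(2) by auto
    have wa: "w a \<noteq> n + a" "w a \<notin> w ` set xs" using w[OF a(1)] a by (auto simp: winj)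
    have wa': "w a \<notin> (+) n ` set xs" using w[OF a(1)] xs by fastforce
    have "foldr (\<circ>) (map (\<lambda>i. shift_map t (n + i) (w i)) (a # xs)) id v =
        shift_map t (n + a) (w a) u"
      by (simp only: list.map foldr_Cons o_apply u_def)
    also have "\<dots> = (\<lambda>x. if x \<in> w ` set (a # xs) then v x + (1 - t) * v (n + inv_into UNIV w x)
           else if x \<in> (+) n ` set (a # xs) then t * v x else v x)"
      using na a(2) wa wa' by (auto simp: fun_eq_iff shift u_na inv_w) (auto simp: IH inv_w)
    finally show ?case .
  qed auto
  have "w ` {1..n} = {1..n}" using permutes_image[OF assms] .
  moreover have "(+) n ` {1..n} = {n + 1..2 * n}" by (simp add: mult_2)
  moreover have "set [1..<n + 1] = {1..n}" by auto
  ultimately show ?thesis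
    unfolding perm_shift_map_def using fold[of "[1..<n + 1]"] by (simp only: distinct_upt order_refl simp_thms)
qed

lemma linear_perm_shift_map:
  assumes "w permutes {1..n}"
  shows "Vector_Spaces.linear cscale cscale (perm_shift_map n t w)"
  by unfold_locales
     (auto simp: perm_shift_map_apply[OF assms] cscale_def algebra_simps fun_eq_iff)

lemma perm_shift_map_span:
  assumes "w permutes {1..n}"
  shows "perm_shift_map n t w ` cv.span (b ` J) = cv.span ((\<lambda>i. perm_shift_map n t w (b i)) ` J)"
proof -
  interpret Vector_Spaces.linear cscale cscale "perm_shift_map n t w"
    using linear_perm_shift_map[OF assms] .
  show ?thesis by (simp add: span_image[symmetric] image_image)
qed

lemma span_scaled_family:
  assumes "c \<noteq> 0"
  shows "cv.span ((\<lambda>i. cscale c (b i)) ` J) = cv.span (b ` J)"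
proof (rule subset_antisym; rule cv.span_minimal[OF _ cv.subspace_span]; rule image_subsetI)
  fix i assume i: "i \<in> J"
  show "cscale c (b i) \<in> cv.span (b ` J)"
    using i by (intro cv.span_scale cv.span_base) blast
  have "b i = cscale (inverse c) (cscale c (b i))" using assms by (simp add: cscale_def fun_eq_iff)
  moreover have "cscale (inverse c) (cscale c (b i)) \<in> cv.span ((\<lambda>i. cscale c (b i)) ` J)"
    using i by (intro cv.span_scale cv.span_base) blast
  ultimately show "b i \<in> cv.span ((\<lambda>i. cscale c (b i)) ` J)" by simp
qed

text \<open>The row \<open>i\<close> acquires \<open>1 - t\<close> in column \<open>w i\<close>, and
  its unit entry on the right becomes \<open>t\<close>. Dividing by \<open>t\<close> returns to the
  chart.\<close>

lemma perm_shift_map_rowspan_aug: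
  assumes w: "w permutes {1..n}" and "t \<noteq> 0"
  shows "perm_shift_map n t w ` rowspan_aug n (2 * n) A =
    rowspan_aug n (2 * n) (\<lambda>k j. (A k j + (if w k = j then 1 - t else 0)) / t)"
    (is "_ = rowspan_aug n (2 * n) ?A")
proof -
  have wi: "w i \<in> {1..n}" if "i \<in> {1..n}" for i
    using permutes_in_image[OF w, of i] that by simp
  have unit: "aug_row n A i (n + inv_into UNIV w x) = (if w i = x then 1 else 0)"
    if "x \<in> {1..n}" for i x
  proof -
    have "inv_into UNIV w x \<in> {1..n}"
      using permutes_in_image[OF permutes_inv[OF w], of x] that by simp
    moreover have "inv_into UNIV w x = i \<longleftrightarrow> w i = x"
      using permutes_inverses[OF w] by metis
    ultimately show ?thesis by (auto simp: aug_row_def)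
  qed
  have "perm_shift_map n t w (aug_row n A i) = cscale t (aug_row n ?A i)" if i: "i \<in> {1..n}" for i
  proof
    fix x
    show "perm_shift_map n t w (aug_row n A i) x = cscale t (aug_row n ?A i) x"
    proof (cases "x \<in> {1..n}")
      case True
      hence "aug_row n A i x = A i x" by (simp only: aug_row_def if_True)
      thus ?thesis using True \<open>t \<noteq> 0\<close> unit[OF True, of i]
        by (simp add: perm_shift_map_apply[OF w] cscale_def aug_row_def[of n ?A])
    next
      case False
      thus ?thesis using i by (auto simp: perm_shift_map_apply[OF w] cscale_def aug_row_def)
    qed
  qed
  hence "(\<lambda>i. perm_shift_map n t w (aug_row n A i)) ` {1..n} = (\<lambda>i. cscale t (aug_row n ?A i)) ` {1..n}"
    by (rule image_cong[OF refl])
  thus ?thesis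
    by (simp only: rowspan_aug_eq_span perm_shift_map_span[OF w] span_scaled_family[OF \<open>t \<noteq> 0\<close>])
qed

text \<open>The right half block is multiplied by \<open>t\<close>, so subspaces outside the chart
  stay outside it.\<close>

lemma pluecker_perm_shift_map_right_half:
  assumes w: "w permutes {1..n}"
  shows "pluecker n (\<lambda>i. perm_shift_map n t w (b i)) {n + 1..2 * n} = t ^ n * pluecker n b {n + 1..2 * n}"
proof -
  have "mat n n (\<lambda>(r, c). perm_shift_map n t w (b (Suc r)) (n + Suc c)) =
        t \<cdot>\<^sub>m mat n n (\<lambda>(r, c). b (Suc r) (n + Suc c))"
    by (rule eq_matI) (auto simp: perm_shift_map_apply[OF w])
  thus ?thesis by (simp only: pluecker_right_half det_smult dim_col_mat)
qed

text \<open>Restriction to the coordinates in \<open>X\<close> is injective on \<open>W\<close>, so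
  it maps a basis of \<open>W\<close> to independent vectors in \<open>coord_span X\<close>.\<close>

lemma dim_le_card_coords:
  assumes W: "cv.subspace W" and X: "finite X"
    and inj: "\<And>v. v \<in> W \<Longrightarrow> (\<And>x. x \<in> X \<Longrightarrow> v x = 0) \<Longrightarrow> v = 0"
  shows "cv.dim W \<le> card X"
proof -
  define f where "f v = (\<lambda>x. if x \<in> X then v x else 0)" for v :: "nat \<Rightarrow> complex"
  interpret f: Vector_Spaces.linear cscale cscale f
    by unfold_locales (auto simp: f_def cscale_def algebra_simps fun_eq_iff)
  have f_inj: "inj_on f W"
  proof (rule inj_onI)
    fix u v assume uv: "u \<in> W" "v \<in> W" "f u = f v"
    have "u - v = 0"
    proof (rule inj)
      show "u - v \<in> W" using W uv by (intro cv.subspace_diff)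
      fix x assume "x \<in> X"
      thus "(u - v) x = 0" using fun_cong[OF uv(3), of x] by (simp add: f_def)
    qed
    thus "u = v" by simp
  qed
  obtain B where B: "B \<subseteq> W" "cv.independent B" "W \<subseteq> cv.span B" "card B = cv.dim W"
    using cv.basis_exists by blast
  have "cv.span B = W" using cv.span_minimal[OF B(1) W] B(3) by (rule subset_antisym)
  hence "inj_on f (cv.span B)" using f_inj by (simp only:)
  with B(2) have "cv.independent (f ` B)" by (rule f.independent_injective_image)
  moreover have "f ` B \<subseteq> cv.span (basis_vec ` X)"
    unfolding coord_span_def[symmetric] coord_span_eq[OF X] f_def by auto
  ultimately have "card (f ` B) \<le> card (basis_vec ` X)"
    using cv.independent_span_bound[OF finite_imageI[OF X]] by blast
  also have "\<dots> \<le> card X" using X by (rule card_image_le)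
  also have "card (f ` B) = card B" using inj_on_subset[OF f_inj B(1)] by (rule card_image)
  finally show ?thesis using B(4) by simp
qed


section \<open>Equations of the flat limit\<close>

definition generic_subspaces :: "nat \<Rightarrow> (nat \<Rightarrow> nat) \<Rightarrow> (nat \<Rightarrow> complex) set set" where
  "generic_subspaces n w = {V \<in> Gr n (2 * n). \<forall>S\<in>perm_rank_set n w. \<forall>T\<in>perm_rank_set n w.
     cv.dim (V \<inter> coord_span (S \<inter> T)) = card {R \<in> perm_rank_set n w. R \<subseteq> S \<inter> T}}"

lemma rank_variety_eq_closure_generic:
  "w permutes {1..n} \<Longrightarrow>
    rank_variety (2 * n) (perm_rank_set n w) = zariski n (2 * n) closure_of generic_subspaces n w"
  by (simp add: rank_variety_def generic_subspaces_def card_perm_rank_set)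

lemma card_perm_rank_subset:
  assumes "w permutes {1..n}"
  shows "card {R \<in> perm_rank_set n w. R \<subseteq> X} = card {i \<in> {1..n}. {w i..i + n} \<subseteq> X}"
proof -
  have "inj_on (\<lambda>i. {w i..i + n}) {1..n}"
  proof (rule inj_onI)
    fix i k assume ik: "i \<in> {1..n}" "k \<in> {1..n}" "{w i..i + n} = {w k..k + n}"
    have "w i \<le> n" using permutes_in_image[OF assms, of i] ik(1) by auto
    thus "i = k" using ik(3) by (auto simp: Icc_eq_Icc)
  qed
  hence "inj_on (\<lambda>i. {w i..i + n}) {i \<in> {1..n}. {w i..i + n} \<subseteq> X}"
    by (rule inj_on_subset) auto
  moreover have "{R \<in> perm_rank_set n w. R \<subseteq> X} = (\<lambda>i. {w i..i + n}) ` {i \<in> {1..n}. {w i..i + n} \<subseteq> X}"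
    by (auto simp: perm_rank_set_def)
  ultimately show ?thesis by (simp only: card_image)
qed

section \<open>The determinantal equation attached to a cell of the diagram\<close>

definition minor_rows :: "(nat \<Rightarrow> nat) \<Rightarrow> nat \<Rightarrow> nat set" where
  "minor_rows w i = {k. 1 \<le> k \<and> k \<le> i \<and> w k \<le> w i}"

text \<open>The matrix \<open>t A - (1 - t) P\<^sub>w\<close> restricted to the rows \<open>K = minor_rows w i\<close> and the columns
  \<open>w (K - {i}) \<union> {j}\<close>, with the last column divided by \<open>t\<close>, padded by an identity matrix; the
  column \<open>w c\<close> has index \<open>c\<close>, and the column \<open>j\<close> has index \<open>i\<close>.\<close>

definition padded_minor ::
    "(nat \<Rightarrow> nat) \<Rightarrow> nat \<Rightarrow> nat \<Rightarrow> (nat \<Rightarrow> nat \<Rightarrow> complex) \<Rightarrow> complex \<Rightarrow> nat \<Rightarrow> nat \<Rightarrow> complex" where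
  "padded_minor w i j A t k c =
     (if k \<in> minor_rows w i \<and> c \<in> minor_rows w i
      then if c = i then A k j else t * A k (w c) - (if k = c then 1 - t else 0)
      else if k = c then 1 else 0)"

text \<open>If the minor were nonzero, a vector of \<open>?V\<close> supported on \<open>?R\<close>
  would be determined by its coordinates \<open>n + k\<close> with \<open>k\<close> in
  \<open>K'\<close>, giving dimension at most \<open>card K'\<close>. The rank condition asks for
  one more, since \<open>?R\<close> contains the intervals of all rows in \<open>K'\<close> and also
  that of row \<open>i\<close>.\<close>

lemma generic_minor_eq_0:
  assumes w: "w permutes {1..n}" and i: "i \<in> {1..n}" and j: "1 \<le> j" "j < w i"
    and V: "rowspan_aug n (2 * n) A \<in> generic_subspaces n w"
  shows "det (mat n n (\<lambda>(r, c). padded_minor w i j A 1 (Suc r) (Suc c))) = 0"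
proof (rule ccontr)
  assume nz: "\<not> ?thesis"
  let ?V = "rowspan_aug n (2 * n) A" and ?R = "{w i..i + n}"
  define K' where "K' = {k \<in> {1..n}. k \<le> i \<and> w i < w k}"
  have wk: "w k \<in> {1..n}" if "k \<in> {1..n}" for k
    using permutes_in_image[OF w, of k] that by simp
  have winj: "w k = w l \<longleftrightarrow> k = l" for k l
    using permutes_inj[OF w] by (auto dest: injD)
  have "?R \<in> perm_rank_set n w" using i by (auto simp: perm_rank_set_def)
  hence "cv.dim (?V \<inter> coord_span ?R) = card {R \<in> perm_rank_set n w. R \<subseteq> ?R}"
    using V by (force simp: generic_subspaces_def)
  also have "\<dots> = card {k \<in> {1..n}. {w k..k + n} \<subseteq> ?R}"
    by (rule card_perm_rank_subset[OF w])
  also have "{k \<in> {1..n}. {w k..k + n} \<subseteq> ?R} = insert i K'"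
  proof -
    have "{w k..k + n} \<subseteq> ?R \<longleftrightarrow> w i \<le> w k \<and> k \<le> i" if "k \<in> {1..n}" for k
      using wk[OF that] that by auto
    moreover have "w i \<le> w k \<longleftrightarrow> k = i \<or> w i < w k" for k using winj[of i k] by auto
    ultimately show ?thesis using i unfolding K'_def by auto
  qed
  also have "card (insert i K') = Suc (card K')" by (simp add: K'_def)
  finally have dim: "cv.dim (?V \<inter> coord_span ?R) = Suc (card K')" .
  have "cv.dim (?V \<inter> coord_span ?R) \<le> card ((+) n ` K')"
  proof (rule dim_le_card_coords)
    show "cv.subspace (?V \<inter> coord_span ?R)"
      using rowspan_aug_in_Gr[of n A] by (intro cv.subspace_inter subspace_coord_span) (simp add: Gr_def)
    show "finite ((+) n ` K')" by (simp add: K'_def)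
  next
    fix v assume v: "v \<in> ?V \<inter> coord_span ?R" and v0: "\<And>x. x \<in> (+) n ` K' \<Longrightarrow> v x = 0"
    obtain x where x: "\<And>c. v c = (\<Sum>k = 1..n. x k * aug_row n A k c)"
      using v by (auto simp: rowspan_aug_eq_span span_family_iff simp del: One_nat_def)
    have vR: "v c = 0" if "c \<notin> ?R" for c
      using v that by (auto simp: coord_span_eq)
    have x_eq: "x k = v (n + k)" if "k \<in> {1..n}" for k
      using sum_aug_row[OF that, of x A] x by simp
    \<comment> \<open>The coefficient is the coordinate \<open>n + k\<close>: for
      \<open>k > i\<close> this index lies beyond \<open>?R\<close>, and for \<open>k\<close> in
      \<open>K'\<close> the coordinate vanishes by assumption.\<close>
    have x0: "x k = 0" if k: "k \<in> {1..n}" "k \<notin> minor_rows w i" for k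
    proof (cases "k \<le> i")
      case True
      hence "k \<in> K'" using k by (auto simp: K'_def minor_rows_def)
      thus ?thesis using x_eq[OF k(1)] v0 by simp
    next
      case False
      thus ?thesis using x_eq[OF k(1)] vR by simp
    qed
    \<comment> \<open>The columns with index in \<open>minor_rows w i\<close> are columns of
      \<open>A\<close> to the left of \<open>w i\<close>, where \<open>v\<close> vanishes.\<close>
    have kernel: "(\<Sum>k = 1..n. x k * padded_minor w i j A 1 k c) = 0" if c: "c \<in> {1..n}" for c
    proof (cases "c \<in> minor_rows w i")
      case False
      have "(\<Sum>k = 1..n. x k * padded_minor w i j A 1 k c) = (\<Sum>k = 1..n. if k = c then x k else 0)"
        using False by (intro sum.cong) (auto simp: padded_minor_def)
      also have "\<dots> = 0" using x0[OF c False] by simp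
      finally show ?thesis .
    next
      case True
      define d where "d = (if c = i then j else w c)"
      have d: "d \<in> {1..n}" "d < w i"
        using True j wk[OF c] wk[OF i] winj[of c i] by (auto simp: d_def minor_rows_def)
      have "(\<Sum>k = 1..n. x k * padded_minor w i j A 1 k c) = (\<Sum>k = 1..n. x k * aug_row n A k d)"
      proof (rule sum.cong)
        fix k assume k: "k \<in> {1..n}"
        show "x k * padded_minor w i j A 1 k c = x k * aug_row n A k d"
        proof (cases "k \<in> minor_rows w i")
          case True
          thus ?thesis using \<open>c \<in> minor_rows w i\<close> d(1) by (simp add: padded_minor_def aug_row_def d_def)
        qed (simp add: x0[OF k])
      qed simp
      also have "\<dots> = v d" by (simp only: x)
      also have "\<dots> = 0" using vR d by simp
      finally show ?thesis .
    qed
    have "x k = 0" if k: "k \<in> {1..n}" for k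
    proof (rule ccontr)
      assume "x k \<noteq> 0"
      hence "det (mat n n (\<lambda>(r, c). padded_minor w i j A 1 (Suc r) (Suc c))) = 0"
        unfolding det_eq_0_iff_left_kernel[where f = "padded_minor w i j A 1"]
        using kernel k by (intro exI[of _ x]) blast
      thus False using nz by contradiction
    qed
    thus "v = 0" by (simp add: x fun_eq_iff)
  qed
  also have "\<dots> \<le> card K'" by (rule card_image_le) (simp add: K'_def)
  finally show False using dim by simp
qed

text \<open>The substitution undoes \<phi> in every column except \<open>i\<close>, which is merely
  divided by \<open>t\<close>: no row \<open>k\<close> of the minor has \<open>w k = j\<close>,
  because \<open>j\<close> is the value of \<open>w\<close> at an index larger than
  \<open>i\<close>.\<close>

lemma padded_minor_shift_eq_0:
  assumes w: "w permutes {1..n}" and "t \<noteq> 0" and ij: "(i, j) \<in> perm_diagram n w"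
    and "det (mat n n (\<lambda>(r, c). padded_minor w i j A 1 (Suc r) (Suc c))) = 0"
  shows "det (mat n n (\<lambda>(r, c). padded_minor w i j
      (\<lambda>k j. (A k j + (if w k = j then 1 - t else 0)) / t) t (Suc r) (Suc c))) = 0"
proof -
  have winj: "w k = w l \<longleftrightarrow> k = l" for k l
    using permutes_inj[OF w] by (auto dest: injD)
  have i: "i \<in> minor_rows w i" and wk: "\<And>k. k \<in> minor_rows w i \<Longrightarrow> w k \<noteq> j"
    using ij by (auto simp: perm_diagram_def minor_rows_def winj)
  let ?A = "\<lambda>k j. (A k j + (if w k = j then 1 - t else 0)) / t"
  have *: "padded_minor w i j ?A t k c = padded_minor w i j A 1 k c * (if c = i then 1 / t else 1)" for k c
    using wk[of k] i \<open>t \<noteq> 0\<close> winj[of k c] by (auto simp: padded_minor_def)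
  obtain x where x: "\<exists>k\<in>{1..n}. x k \<noteq> 0"
      "\<And>c. c \<in> {1..n} \<Longrightarrow> (\<Sum>k = 1..n. x k * padded_minor w i j A 1 k c) = 0"
    using assms(4) unfolding det_eq_0_iff_left_kernel[where f = "padded_minor w i j A 1"] by blast
  have "(\<Sum>k = 1..n. x k * padded_minor w i j ?A t k c) = 0" if "c \<in> {1..n}" for c
    using x(2)[OF that] by (simp only: * mult.assoc[symmetric] sum_distrib_right[symmetric] mult_zero_left)
  thus ?thesis unfolding det_eq_0_iff_left_kernel[where f = "padded_minor w i j ?A t"]
    using x(1) by (intro exI[of _ x]) blast
qed

text \<open>At \<open>t = 0\<close> only column \<open>i\<close> keeps off-diagonal entries. They
  lie in rows \<open>k \<le> i\<close>, so the matrix is upper triangular, and its diagonal entries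
  other than \<open>A i j\<close> are 1 or -1.\<close>

lemma padded_minor_limit:
  assumes "det (mat n n (\<lambda>(r, c). padded_minor w i j A 0 (Suc r) (Suc c))) = 0"
  shows "A i j = 0"
proof -
  let ?M = "mat n n (\<lambda>(r, c). padded_minor w i j A 0 (Suc r) (Suc c))"
  have "upper_triangular ?M"
    by (rule upper_triangularI) (auto simp: padded_minor_def minor_rows_def)
  hence "prod_list (diag_mat ?M) = 0" using det_upper_triangular[of ?M n] assms by simp
  hence "0 \<in> set (diag_mat ?M)" by (simp add: prod_list_zero_iff)
  then obtain r where "r < n" "padded_minor w i j A 0 (Suc r) (Suc r) = 0"
    by (auto simp: diag_mat_def)
  thus ?thesis by (auto simp: padded_minor_def split: if_splits)
qed

text \<open>The padded minor is turned into a family of forms by replacing the entries of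
  \<open>A\<close> with the linear forms that return them on the chart.\<close>

lemma limit_equation:
  assumes w: "w permutes {1..n}" and ij: "(i, j) \<in> perm_diagram n w"
  shows "\<exists>f \<in> family_forms n (2 * n) (1 + n).
    (\<forall>t. t \<noteq> 0 \<longrightarrow> (\<forall>V \<in> rank_variety (2 * n) (perm_rank_set n w).
       vanishes_at n (f t) (perm_shift_map n t w ` V))) \<and>
    (\<forall>A. f 0 (pluecker n (aug_row n A)) = 0 \<longrightarrow> A i j = 0)"
proof -
  have wk: "w k \<in> {1..n}" if "k \<in> {1..n}" for k
    using permutes_in_image[OF w, of k] that by simp
  have i: "i \<in> {1..n}" and j: "j \<in> {1..n}" "j < w i"
    using ij wk by (auto simp: perm_diagram_def)
  have "\<forall>k\<in>{1..n}. \<forall>c\<in>{1..n}. \<exists>q. q \<in> forms n (2 * n) 1 \<and> (\<forall>A. q (pluecker n (aug_row n A)) = A k c)"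
    using matrix_entry_form by blast
  then obtain q where q: "\<And>k c. k \<in> {1..n} \<Longrightarrow> c \<in> {1..n} \<Longrightarrow> q k c \<in> forms n (2 * n) 1"
      "\<And>k c A. k \<in> {1..n} \<Longrightarrow> c \<in> {1..n} \<Longrightarrow> q k c (pluecker n (aug_row n A)) = A k c"
    by metis
  define p\<^sub>0 :: "(nat set \<Rightarrow> complex) \<Rightarrow> complex" where "p\<^sub>0 p = p {n + 1..2 * n}" for p
  have p\<^sub>0: "p\<^sub>0 \<in> forms n (2 * n) 1" "\<And>A. p\<^sub>0 (pluecker n (aug_row n A)) = 1"
    using right_half_form pluecker_aug_row_right_half by (simp_all add: p\<^sub>0_def[abs_def])
  \<comment> \<open>Constants are multiplied by \<open>p\<^sub>0\<close>, which is 1 on the chart,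
    so that every entry is homogeneous of degree 1.\<close>
  define E where "E k c t p =
     (if k \<in> minor_rows w i \<and> c \<in> minor_rows w i
      then if c = i then q k j p else t * q k (w c) p - (if k = c then (1 - t) * p\<^sub>0 p else 0)
      else if k = c then p\<^sub>0 p else 0)" for k c t p
  \<comment> \<open>The factor \<open>p\<^sub>0\<close> makes it enough to check the vanishing of \<open>f t\<close> on the chart.\<close>
  define f where "f t p = p\<^sub>0 p * det (mat n n (\<lambda>(r, c). E (Suc r) (Suc c) t p))" for t p
  have E: "E k c \<in> family_forms n (2 * n) 1" if k: "k \<in> {1..n}" and c: "c \<in> {1..n}" for k c
  proof -
    have t_form: "(\<lambda>t p. t * g p) \<in> family_forms n (2 * n) 1" if "g \<in> forms n (2 * n) 1" for g
      using family_forms_monomial[OF that, of 1] by simp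
    have "(\<lambda>t p. t * q k (w c) p - (if k = c then (1 - t) * p\<^sub>0 p else 0)) \<in> family_forms n (2 * n) 1"
    proof (cases "k = c")
      case True
      have "(\<lambda>t p. t * (q k (w c) p + p\<^sub>0 p) + (- 1) * p\<^sub>0 p) \<in> family_forms n (2 * n) 1"
        by (intro family_forms_add t_form family_forms_const forms_add forms_cmult q p\<^sub>0 k wk c)
      thus ?thesis using True by (simp add: algebra_simps)
    qed (use t_form q(1)[OF k wk[OF c]] in simp)
    moreover have "(\<lambda>t p. q k j p) \<in> family_forms n (2 * n) 1"
      by (intro family_forms_const q k j)
    moreover have "(\<lambda>t p. p\<^sub>0 p) \<in> family_forms n (2 * n) 1" by (intro family_forms_const p\<^sub>0)
    moreover have "(\<lambda>t p. 0) \<in> family_forms n (2 * n) 1" by (intro family_forms_const zero_form)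
    ultimately show ?thesis
      unfolding E_def[abs_def]
      by (cases "k \<in> minor_rows w i \<and> c \<in> minor_rows w i"; cases "c = i"; cases "k = c")
         (simp_all only: if_True if_False simp_thms)
  qed
  have f_family: "f \<in> family_forms n (2 * n) (1 + n)"
    unfolding f_def[abs_def]
    by (intro family_forms_mult family_forms_const p\<^sub>0 family_forms_det E) auto
  hence f_form: "f t \<in> forms n (2 * n) (1 + n)" for t by (rule family_forms_specialise)
  have f_chart: "f t (pluecker n (aug_row n A)) =
      det (mat n n (\<lambda>(r, c). padded_minor w i j A t (Suc r) (Suc c)))" for t A
  proof -
    have "E k c t (pluecker n (aug_row n A)) = padded_minor w i j A t k c"
      if "k \<in> {1..n}" "c \<in> {1..n}" for k c
      using that q(2) wk[OF that(2)] j p\<^sub>0(2) by (simp add: E_def padded_minor_def)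
    hence "mat n n (\<lambda>(r, c). E (Suc r) (Suc c) t (pluecker n (aug_row n A))) =
        mat n n (\<lambda>(r, c). padded_minor w i j A t (Suc r) (Suc c))"
      by (intro cong_mat) auto
    thus ?thesis by (simp add: f_def p\<^sub>0(2))
  qed
  have f_vanishes: "vanishes_at n (f t) V"
    if V: "V \<in> Gr n (2 * n)" and minor: "\<And>A. V = rowspan_aug n (2 * n) A \<Longrightarrow>
      det (mat n n (\<lambda>(r, c). padded_minor w i j A t (Suc r) (Suc c))) = 0" for t V
  proof -
    obtain b where b: "cv.span (b ` {1..n}) = V" using Gr_spanning_family V by blast
    show ?thesis
    proof (cases "pluecker n b {n + 1..2 * n} = 0")
      case True
      thus ?thesis unfolding vanishes_at_iff[OF f_form b] by (simp add: f_def p\<^sub>0_def)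
    next
      case False
      then obtain A where A: "V = rowspan_aug n (2 * n) A"
        using Gr_right_half_chart[OF V b] by blast
      show ?thesis
        unfolding vanishes_at_iff[OF f_form A[symmetric, unfolded rowspan_aug_eq_span]] f_chart
        by (rule minor[OF A])
    qed
  qed
  \<comment> \<open>The rank conditions enter at \<open>t = 1\<close> only, where the equation
    extends from generic subspaces to their closure. Other values of \<open>t\<close> are reached by
    \<open>padded_minor_shift_eq_0\<close>.\<close>
  have "rank_variety (2 * n) (perm_rank_set n w) \<subseteq> zero_locus n (2 * n) {f 1}"
    unfolding rank_variety_eq_closure_generic[OF w]
  proof (rule closure_of_minimal)
    show "closedin (zariski n (2 * n)) (zero_locus n (2 * n) {f 1})"
      using f_form unfolding closedin_zariski by (intro exI[of _ "{f 1}"]) auto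
    show "generic_subspaces n w \<subseteq> zero_locus n (2 * n) {f 1}"
    proof
      fix V assume V: "V \<in> generic_subspaces n w"
      hence "V \<in> Gr n (2 * n)" by (simp add: generic_subspaces_def)
      moreover have "vanishes_at n (f 1) V"
        using V j by (intro f_vanishes calculation generic_minor_eq_0[OF w i]) auto
      ultimately show "V \<in> zero_locus n (2 * n) {f 1}" by (simp add: zero_locus_def)
    qed
  qed
  hence \<Sigma>: "V \<in> Gr n (2 * n)" "vanishes_at n (f 1) V"
    if "V \<in> rank_variety (2 * n) (perm_rank_set n w)" for V
    using that by (auto simp: zero_locus_def)
  have "vanishes_at n (f t) (perm_shift_map n t w ` V)"
    if t: "t \<noteq> 0" and V: "V \<in> rank_variety (2 * n) (perm_rank_set n w)" for t V
  proof -
    obtain b where b: "cv.span (b ` {1..n}) = V" using Gr_spanning_family \<Sigma>(1)[OF V] by blast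
    hence \<phi>b: "cv.span ((\<lambda>i. perm_shift_map n t w (b i)) ` {1..n}) = perm_shift_map n t w ` V"
      using perm_shift_map_span[OF w] by metis
    show ?thesis
    proof (cases "pluecker n b {n + 1..2 * n} = 0")
      \<comment> \<open>The image under \<phi> lies outside the chart too, and the factor
        \<open>p\<^sub>0\<close> vanishes there.\<close>
      case True
      thus ?thesis unfolding vanishes_at_iff[OF f_form \<phi>b]
        by (simp only: f_def p\<^sub>0_def pluecker_perm_shift_map_right_half[OF w] mult_zero_left mult_zero_right)
    next
      case False
      then obtain A where A: "V = rowspan_aug n (2 * n) A"
        using Gr_right_half_chart[OF \<Sigma>(1)[OF V] b] by blast
      have "det (mat n n (\<lambda>(r, c). padded_minor w i j A 1 (Suc r) (Suc c))) = 0"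
        using \<Sigma>(2)[OF V]
        unfolding vanishes_at_iff[OF f_form A[symmetric, unfolded rowspan_aug_eq_span]] f_chart .
      hence "det (mat n n (\<lambda>(r, c). padded_minor w i j
          (\<lambda>k j. (A k j + (if w k = j then 1 - t else 0)) / t) t (Suc r) (Suc c))) = 0"
        by (rule padded_minor_shift_eq_0[OF w t ij])
      moreover have "perm_shift_map n t w ` V = cv.span (aug_row n
          (\<lambda>k j. (A k j + (if w k = j then 1 - t else 0)) / t) ` {1..n})"
        unfolding rowspan_aug_eq_span[symmetric] A by (rule perm_shift_map_rowspan_aug[OF w t])
      ultimately show ?thesis
        by (simp only: vanishes_at_iff[OF f_form refl] f_chart)
    qed
  qed
  moreover have "A i j = 0" if "f 0 (pluecker n (aug_row n A)) = 0" for A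
    using that unfolding f_chart by (rule padded_minor_limit)
  ultimately show ?thesis using f_family by (intro bexI[of _ f]) auto
qed


section \<open>Points of the flat limit\<close>

text \<open>Only supports are prescribed, not independence: these families form a linear space, in
  which any two can be joined by a line.\<close>

definition interval_families :: "nat \<Rightarrow> (nat \<Rightarrow> nat) \<Rightarrow> (nat \<Rightarrow> nat \<Rightarrow> complex) set" where
  "interval_families n w = {v. \<forall>i\<in>{1..n}. \<forall>x. x \<notin> {w i..i + n} \<longrightarrow> v i x = 0}"

definition rows_outside :: "nat \<Rightarrow> (nat \<Rightarrow> nat) \<Rightarrow> nat set \<Rightarrow> nat set" where
  "rows_outside n w X = {i \<in> {1..n}. \<not> {w i..i + n} \<subseteq> X}"

text \<open>Every interval \<open>[w(c), n + c]\<close> not contained in \<open>X\<close> has an endpoint outside \<open>X\<close>, and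
  these endpoints are distinct: they are the columns of the following minor.\<close>

definition generic_minor ::
    "nat \<Rightarrow> (nat \<Rightarrow> nat) \<Rightarrow> nat set \<Rightarrow> (nat \<Rightarrow> nat \<Rightarrow> complex) \<Rightarrow> nat \<Rightarrow> nat \<Rightarrow> complex" where
  "generic_minor n w X v k c =
     (if c \<in> rows_outside n w X then v k (if w c \<notin> X then w c else n + c) else if k = c then 1 else 0)"

text \<open>The sets \<open>X\<close> for which \<open>dim (V \<inter> \<langle>X\<rangle>)\<close> is prescribed; the empty set encodes \<open>dim V = n\<close>.\<close>

definition rank_conditions :: "nat \<Rightarrow> (nat \<Rightarrow> nat) \<Rightarrow> nat set set" where
  "rank_conditions n w = insert {} ((\<lambda>(S, T). S \<inter> T) ` (perm_rank_set n w \<times> perm_rank_set n w))"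

text \<open>Convexity of \<open>X\<close> ensures that an interval not contained in \<open>X\<close>
  has an endpoint outside.\<close>

lemma rank_conditions_interval:
  assumes "X \<in> rank_conditions n w"
  obtains a b where "X = {a..b}"
proof -
  have "{} = {1..0 :: nat}" by simp
  moreover have "{a..b} \<inter> {c..d} = {max a c..min b d}" for a b c d :: nat by (rule Int_atLeastAtMost)
  ultimately show ?thesis
    using assms that unfolding rank_conditions_def perm_rank_set_def by fastforce
qed

lemma finite_rank_conditions: "finite (rank_conditions n w)"
proof -
  have "perm_rank_set n w = (\<lambda>i. {w i..i + n}) ` {1..n}" by (auto simp: perm_rank_set_def)
  thus ?thesis by (simp add: rank_conditions_def)
qed

text \<open>Rows whose interval lies in \<open>X\<close> vanish at the columns of the minor, which
  are all outside \<open>X\<close>. Hence \<open>x\<close>, cut down to \<open>rows_outside\<close>,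
  is a relation between the rows of the minor.\<close>

lemma generic_minor_coefficients_eq_0:
  assumes v: "v \<in> interval_families n w" and X: "X \<in> rank_conditions n w"
    and nz: "det (mat n n (\<lambda>(r, c). generic_minor n w X v (Suc r) (Suc c))) \<noteq> 0"
    and x: "\<And>c. c \<notin> X \<Longrightarrow> (\<Sum>i = 1..n. x i * v i c) = 0"
    and i: "i \<in> rows_outside n w X"
  shows "x i = 0"
proof (rule ccontr)
  assume "x i \<noteq> 0"
  define y where "y k = (if k \<in> rows_outside n w X then x k else 0)" for k
  have "(\<Sum>k = 1..n. y k * generic_minor n w X v k c) = 0" if c: "c \<in> {1..n}" for c
  proof (cases "c \<in> rows_outside n w X")
    case True
    define d where "d = (if w c \<notin> X then w c else n + c)"
    obtain a b where ab: "X = {a..b}" using rank_conditions_interval[OF X] .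
    \<comment> \<open>If \<open>w c\<close> lies in \<open>X\<close>, then \<open>n + c\<close> does
      not, as otherwise the interval would be contained in \<open>X\<close>.\<close>
    have d: "d \<notin> X" using True by (auto simp: ab d_def rows_outside_def)
    have "y k * generic_minor n w X v k c = x k * v k d" if k: "k \<in> {1..n}" for k
    proof (cases "k \<in> rows_outside n w X")
      case False
      hence "d \<notin> {w k..k + n}" using d k by (auto simp: rows_outside_def)
      hence "v k d = 0" using v k by (auto simp: interval_families_def)
      thus ?thesis using False by (simp add: y_def)
    qed (use True in \<open>simp add: y_def generic_minor_def d_def\<close>)
    hence "(\<Sum>k = 1..n. y k * generic_minor n w X v k c) = (\<Sum>k = 1..n. x k * v k d)"
      by (intro sum.cong) auto
    thus ?thesis using x[OF d] by simp
  next
    case False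
    have "(\<Sum>k = 1..n. y k * generic_minor n w X v k c) = (\<Sum>k = 1..n. if k = c then y k else 0)"
      using False by (intro sum.cong) (auto simp: generic_minor_def)
    thus ?thesis using False by (simp add: y_def)
  qed
  moreover have "y i \<noteq> 0" "i \<in> {1..n}"
    using i \<open>x i \<noteq> 0\<close> by (auto simp: y_def rows_outside_def)
  ultimately have "det (mat n n (\<lambda>(r, c). generic_minor n w X v (Suc r) (Suc c))) = 0"
    unfolding det_eq_0_iff_left_kernel[where f = "generic_minor n w X v"]
    by (intro exI[of _ y]) blast
  thus False using nz by contradiction
qed

text \<open>A combination of the \<open>v i\<close> that lies in \<open>coord_span X\<close> uses
  only rows with interval inside \<open>X\<close>, so these rows form a basis of the
  intersection.\<close>

lemma span_in_generic_subspaces: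
  assumes w: "w permutes {1..n}" and v: "v \<in> interval_families n w"
    and nz: "\<And>X. X \<in> rank_conditions n w \<Longrightarrow>
      det (mat n n (\<lambda>(r, c). generic_minor n w X v (Suc r) (Suc c))) \<noteq> 0"
  shows "cv.span (v ` {1..n}) \<in> generic_subspaces n w"
proof -
  have wk: "w k \<in> {1..n}" if "k \<in> {1..n}" for k
    using permutes_in_image[OF w, of k] that by simp
  have ind: "independent_family {1..n} v"
    unfolding independent_family_def
  proof (intro allI impI ballI)
    fix x i assume "\<forall>c. (\<Sum>i = 1..n. x i * v i c) = 0" and i: "i \<in> {1..n}"
    \<comment> \<open>For the empty \<open>X\<close> every row is outside, and the coefficient lemma
      becomes independence of \<open>v\<close>.\<close>
    moreover have "{} \<in> rank_conditions n w" by (simp add: rank_conditions_def)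
    moreover have "i \<in> rows_outside n w {}" using i wk[OF i] by (auto simp: rows_outside_def)
    ultimately show "x i = 0" using generic_minor_coefficients_eq_0[OF v _ nz] by blast
  qed
  have supp: "v i \<in> coord_span X" if "i \<in> {1..n}" "{w i..i + n} \<subseteq> X" "finite X" for i X
  proof -
    have "v i x = 0" if "x \<notin> X" for x
      using v that \<open>i \<in> {1..n}\<close> \<open>{w i..i + n} \<subseteq> X\<close> unfolding interval_families_def by blast
    thus ?thesis by (simp add: coord_span_eq[OF \<open>finite X\<close>])
  qed
  have "v i \<in> coord_span {1..2 * n}" if "i \<in> {1..n}" for i
    using that wk[OF that] by (intro supp) auto
  hence "cv.span (v ` {1..n}) \<subseteq> coord_span {1..2 * n}"
    by (intro cv.span_minimal subspace_coord_span) blast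
  moreover have "cv.dim (cv.span (v ` {1..n})) = n"
    using dim_span_independent_family[OF ind] by simp
  ultimately have "cv.span (v ` {1..n}) \<in> Gr n (2 * n)"
    by (simp only: Gr_def mem_Collect_eq cv.subspace_span simp_thms)
  moreover have "cv.dim (cv.span (v ` {1..n}) \<inter> coord_span X) = card {R \<in> perm_rank_set n w. R \<subseteq> X}"
    if X: "X \<in> rank_conditions n w" for X
  proof -
    let ?I = "{i \<in> {1..n}. {w i..i + n} \<subseteq> X}"
    obtain a b where "X = {a..b}" using rank_conditions_interval[OF X] .
    hence fin: "finite X" by simp
    have "cv.span (v ` {1..n}) \<inter> coord_span X = cv.span (v ` ?I)"
    proof
      have "v ` ?I \<subseteq> coord_span X" using supp fin by auto
      hence "cv.span (v ` ?I) \<subseteq> coord_span X" by (rule cv.span_minimal[OF _ subspace_coord_span])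
      moreover have "cv.span (v ` ?I) \<subseteq> cv.span (v ` {1..n})" by (rule cv.span_mono) auto
      ultimately show "cv.span (v ` ?I) \<subseteq> cv.span (v ` {1..n}) \<inter> coord_span X" by blast
    next
      show "cv.span (v ` {1..n}) \<inter> coord_span X \<subseteq> cv.span (v ` ?I)"
      proof
        fix u assume u: "u \<in> cv.span (v ` {1..n}) \<inter> coord_span X"
        then obtain x where x: "\<And>c. u c = (\<Sum>i = 1..n. x i * v i c)"
          using span_family_iff[of "{1..n}" u v] by auto
        have "x i = 0" if "i \<in> rows_outside n w X" for i
        proof (rule generic_minor_coefficients_eq_0[OF v X nz[OF X] _ that])
          fix c assume "c \<notin> X"
          thus "(\<Sum>i = 1..n. x i * v i c) = 0" using u x[of c] by (simp add: coord_span_eq[OF fin])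
        qed
        hence x0: "x i = 0" if "i \<in> {1..n} - ?I" for i
          using that by (auto simp: rows_outside_def)
        have "u c = (\<Sum>i\<in>?I. x i * v i c)" for c
          unfolding x using x0 by (intro sum.mono_neutral_right) auto
        thus "u \<in> cv.span (v ` ?I)" using span_family_iff[of ?I u v] by auto
      qed
    qed
    moreover have "independent_family ?I v" by (rule independent_family_subset[OF ind]) auto
    ultimately have "cv.dim (cv.span (v ` {1..n}) \<inter> coord_span X) = card ?I"
      by (simp only: dim_span_independent_family finite_Collect_conjI finite_atLeastAtMost
          Collect_mem_eq simp_thms)
    thus ?thesis by (simp only: card_perm_rank_subset[OF w])
  qed
  moreover have "S \<inter> T \<in> rank_conditions n w" if "S \<in> perm_rank_set n w" "T \<in> perm_rank_set n w" for S T
    using that by (auto simp: rank_conditions_def)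
  ultimately show ?thesis by (simp add: generic_subspaces_def)
qed

text \<open>The family \<open>e\<^bsub>w(i)\<^esub> + e\<^bsub>n+i\<^esub>\<close> is generic: its rows have disjoint supports, so every one of the
  minors is the identity matrix. Joining an arbitrary family to it by a line exhibits the former as a
  limit of generic ones.\<close>

definition endpoint_family :: "nat \<Rightarrow> (nat \<Rightarrow> nat) \<Rightarrow> nat \<Rightarrow> nat \<Rightarrow> complex" where
  "endpoint_family n w i = (\<lambda>x. if x = w i \<or> x = n + i then 1 else 0)"

text \<open>Along the line \<open>u\<close> the form vanishes wherever \<open>u s\<close> is
  generic, hence also at \<open>s = 0\<close>. The conclusion concerns the Pluecker vector and not
  the span, since \<open>v\<close> may be dependent.\<close>

lemma form_vanishes_on_interval_families:
  assumes w: "w permutes {1..n}" and f: "f \<in> forms n (2 * n) d"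
    and van: "\<And>V. V \<in> generic_subspaces n w \<Longrightarrow> vanishes_at n f (perm_shift_map n t w ` V)"
    and v: "v \<in> interval_families n w"
  shows "f (pluecker n (\<lambda>i. perm_shift_map n t w (v i))) = 0"
proof -
  have wk: "w k \<in> {1..n}" if "k \<in> {1..n}" for k
    using permutes_in_image[OF w, of k] that by simp
  have winj: "w k = w l \<longleftrightarrow> k = l" for k l
    using permutes_inj[OF w] by (auto dest: injD)
  define u where "u s i x = v i x + s * (endpoint_family n w i x - v i x)" for s i x
  have u_poly: "univariate_poly (\<lambda>s. u s i x)" for i x
    unfolding u_def by (intro univariate_poly_intros)
  have u: "u s \<in> interval_families n w" for s
    unfolding interval_families_def
  proof (intro CollectI ballI allI impI)
    fix i x assume i: "i \<in> {1..n}" and x: "x \<notin> {w i..i + n}"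
    have "v i x = 0" using v i x by (auto simp: interval_families_def)
    moreover have "endpoint_family n w i x = 0"
      using x wk[OF i] by (auto simp: endpoint_family_def)
    ultimately show "u s i x = 0" by (simp add: u_def)
  qed
  \<comment> \<open>A nonzero value of \<open>g\<close> certifies all rank conditions at
    once.\<close>
  define g where "g s = (\<Prod>X \<in> rank_conditions n w.
      det (mat n n (\<lambda>(r, c). generic_minor n w X (u s) (Suc r) (Suc c))))" for s
  define h where "h s = f (pluecker n (\<lambda>i. perm_shift_map n t w (u s i)))" for s
  have "univariate_poly g"
    unfolding g_def[abs_def]
  proof (intro univariate_poly_prod univariate_poly_det)
    fix X k c
    show "univariate_poly (\<lambda>s. generic_minor n w X (u s) (Suc k) (Suc c))"
      unfolding generic_minor_def by (intro univariate_poly_if u_poly univariate_poly_const)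
  qed
  moreover have "univariate_poly h"
    unfolding h_def
  proof (rule univariate_poly_poly_funs[where f = f
      and p = "\<lambda>s. pluecker n (\<lambda>i. perm_shift_map n t w (u s i))"])
    show "f \<in> poly_funs {I. I \<subseteq> {1..2 * n} \<and> card I = n}" using f by (simp add: forms_def)
    show "univariate_poly (\<lambda>s. pluecker n (\<lambda>i. perm_shift_map n t w (u s i)) I)" for I
    proof (rule univariate_poly_pluecker)
      fix i x
      show "univariate_poly (\<lambda>s. perm_shift_map n t w (u s i) x)"
        unfolding perm_shift_map_apply[OF w]
        by (intro univariate_poly_if univariate_poly_add univariate_poly_mult univariate_poly_const u_poly)
    qed
  qed
  moreover have "h s = 0" if "g s \<noteq> 0" for s
  proof -
    have "cv.span (u s ` {1..n}) \<in> generic_subspaces n w"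
    proof (rule span_in_generic_subspaces[OF w u])
      fix X assume "X \<in> rank_conditions n w"
      thus "det (mat n n (\<lambda>(r, c). generic_minor n w X (u s) (Suc r) (Suc c))) \<noteq> 0"
        using that finite_rank_conditions[of n w] unfolding g_def prod_zero_iff[OF finite_rank_conditions]
        by blast
    qed
    hence "vanishes_at n f (cv.span ((\<lambda>i. perm_shift_map n t w (u s i)) ` {1..n}))"
      unfolding perm_shift_map_span[OF w, symmetric] by (rule van)
    thus ?thesis unfolding h_def by (simp only: vanishes_at_iff[OF f refl])
  qed
  moreover have "g 1 \<noteq> 0"
  proof -
    have "mat n n (\<lambda>(r, c). generic_minor n w X (u 1) (Suc r) (Suc c)) = 1\<^sub>m n" for X
    proof (rule eq_matI)
      fix r c assume "r < dim_row (1\<^sub>m n :: complex mat)" "c < dim_col (1\<^sub>m n :: complex mat)"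
      hence rc: "Suc r \<in> {1..n}" "Suc c \<in> {1..n}" by auto
      have "generic_minor n w X (u 1) (Suc r) (Suc c) = (if r = c then 1 else 0)"
        using wk[OF rc(1)] wk[OF rc(2)] winj[of "Suc r" "Suc c"]
        by (auto simp: generic_minor_def u_def endpoint_family_def)
      thus "mat n n (\<lambda>(r, c). generic_minor n w X (u 1) (Suc r) (Suc c)) $$ (r, c) = 1\<^sub>m n $$ (r, c)"
        using rc by simp
    qed auto
    thus ?thesis by (simp add: g_def)
  qed
  ultimately have "h 0 = 0" by (rule univariate_poly_eq_0)
  moreover have "u 0 = v" by (simp add: u_def fun_eq_iff)
  ultimately show ?thesis by (simp add: h_def)
qed

text \<open>For \<open>t \<noteq> 0\<close> the map sends the family \<open>v t\<close> to
  \<open>t\<close> times \<open>u t\<close>. By homogeneity \<open>f t\<close> vanishes at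
  \<open>u t\<close>, and this extends to \<open>t = 0\<close>, where \<open>u\<close> becomes
  \<open>[A | I]\<close>.\<close>

lemma diagram_chart_in_limit:
  assumes w: "w permutes {1..n}" and A: "\<And>i j. (i, j) \<in> perm_diagram n w \<Longrightarrow> A i j = 0"
    and f: "f \<in> family_forms n (2 * n) d"
    and van: "\<And>t V. t \<noteq> 0 \<Longrightarrow> V \<in> generic_subspaces n w \<Longrightarrow>
      vanishes_at n (f t) (perm_shift_map n t w ` V)"
  shows "f 0 (pluecker n (aug_row n A)) = 0"
proof -
  have wk: "w k \<in> {1..n}" if "k \<in> {1..n}" for k
    using permutes_in_image[OF w, of k] that by simp
  let ?w' = "inv_into UNIV w"
  have w': "?w' x \<in> {1..n}" "w (?w' x) = x" if "x \<in> {1..n}" for x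
    using permutes_in_image[OF permutes_inv[OF w], of x] permutes_inverses[OF w] that by auto
  \<comment> \<open>\<open>v t\<close> is chosen so that \<open>\<phi>\<^bsub>t,w\<^esub>\<close> maps it to \<open>t [C | B]\<close>. Left of \<open>w(i)\<close>, the entries of row \<open>i\<close> of
    \<open>v t\<close> have to vanish, hence the \<open>t A\<close> of \<open>\<phi>\<^bsub>t,w\<^esub> (v t)\<close> must there come from the off-diagonal
    entries of \<open>B\<close>; this is possible exactly outside the diagram of \<open>w\<close>.\<close>
  define B :: "complex \<Rightarrow> nat \<Rightarrow> nat \<Rightarrow> complex" where
    "B t i k = (if k = i then 1 else if k < i \<and> w k < w i then t * A i (w k) else 0)" for t i k
  \<comment> \<open>Left of \<open>w i\<close>, the factor \<open>1 - t\<close> makes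
    \<open>t * C\<close> cancel against \<open>(1 - t) * B\<close>; it is 1 at \<open>t = 0\<close>
    and leaves the limit unchanged.\<close>
  define C where "C t i x = (if w i \<le> x then A i x else (1 - t) * A i x)" for t i x
  define u where "u t i x =
    (if x \<in> {1..n} then C t i x else if x \<in> {n + 1..2 * n} then B t i (x - n) else 0)" for t i x
  define v where "v t i x =
    (if x \<in> {1..n} then t * C t i x - (1 - t) * B t i (?w' x)
     else if x \<in> {n + 1..2 * n} then B t i (x - n) else 0)" for t i x
  have shift: "perm_shift_map n t w (v t i) = cscale t (u t i)" for t i
    unfolding perm_shift_map_apply[OF w]
  proof
    fix x
    show "(if x \<in> {1..n} then v t i x + (1 - t) * v t i (n + ?w' x)
         else if x \<in> {n + 1..2 * n} then t * v t i x else v t i x) = cscale t (u t i) x"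
    proof (cases "x \<in> {1..n}")
      case True
      thus ?thesis using w'[OF True] by (simp add: v_def u_def cscale_def)
    qed (auto simp: v_def u_def cscale_def)
  qed
  have v: "v t \<in> interval_families n w" for t
    unfolding interval_families_def
  proof (intro CollectI ballI allI impI)
    fix i x assume i: "i \<in> {1..n}" and x: "x \<notin> {w i..i + n}"
    consider "x \<in> {1..n}" "x < w i" | "x \<in> {n + 1..2 * n}" "i < x - n" | "x \<notin> {1..2 * n}"
    proof -
      have "x \<in> {1..n} \<and> x < w i \<or> x \<in> {n + 1..2 * n} \<and> i < x - n \<or> x \<notin> {1..2 * n}"
        using x i wk[OF i] by auto
      thus thesis using that by blast
    qed
    thus "v t i x = 0"
    proof cases
      case 1
      have "?w' x \<noteq> i" using w'[OF 1(1)] 1(2) by auto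
      show ?thesis
      \<comment> \<open>If the row index with value \<open>x\<close> precedes \<open>i\<close>, the
        two terms of \<open>v\<close> cancel; if it follows \<open>i\<close>, the position
        \<open>(i, x)\<close> belongs to the diagram and \<open>A i x\<close> is zero.\<close>
      proof (cases "?w' x < i")
        case True
        thus ?thesis using 1 w'[OF 1(1)] by (simp add: v_def B_def C_def)
      next
        case False
        hence "(i, w (?w' x)) \<in> perm_diagram n w"
          using i w'[OF 1(1)] 1(2) \<open>?w' x \<noteq> i\<close> unfolding perm_diagram_def
          by (intro CollectI exI[of _ i] exI[of _ "?w' x"]) auto
        hence "A i x = 0" using A w'[OF 1(1)] by simp
        thus ?thesis using 1 False \<open>?w' x \<noteq> i\<close> by (simp add: v_def B_def C_def)
      qed
    qed (auto simp: v_def B_def)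
  qed
  define h where "h t = f t (pluecker n (u t))" for t
  have "h t = 0" if t: "t \<noteq> 0" for t
  proof -
    have ft: "f t \<in> forms n (2 * n) d" using f by (rule family_forms_specialise)
    have "0 = f t (pluecker n (\<lambda>i. perm_shift_map n t w (v t i)))"
      using form_vanishes_on_interval_families[OF w ft van[OF t] v] by simp
    also have "\<dots> = f t (\<lambda>I. t ^ n * pluecker n (u t) I)"
      by (simp only: shift pluecker_scale[abs_def])
    also have "\<dots> = (t ^ n) ^ d * h t" using ft by (simp add: forms_def h_def)
    finally show ?thesis using t by simp
  qed
  moreover have "univariate_poly h"
    unfolding h_def
  proof (rule univariate_poly_family_forms[OF f], rule univariate_poly_pluecker)
    fix i x
    have "univariate_poly (\<lambda>t. B t i k)" for k
      unfolding B_def by (intro univariate_poly_intros)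
    moreover have "univariate_poly (\<lambda>t. C t i x)"
      unfolding C_def by (intro univariate_poly_intros)
    ultimately show "univariate_poly (\<lambda>t. u t i x)"
      unfolding u_def by (intro univariate_poly_if univariate_poly_const)
  qed
  ultimately have "h 0 = 0"
    using univariate_poly_eq_0[OF univariate_poly_id, of h 1] by simp
  moreover have "u 0 i = aug_row n A i" if "i \<in> {1..n}" for i
    using that by (auto simp: u_def aug_row_def B_def C_def fun_eq_iff)
  hence "pluecker n (u 0) = pluecker n (aug_row n A)" by (rule pluecker_cong)
  ultimately show ?thesis by (simp add: h_def)
qed


section \<open>The irreducible component\<close>

lemma closedin_zero_locus_form:
  "f \<in> forms k m d \<Longrightarrow> closedin (zariski k m) (zero_locus k m {f})"
  unfolding closedin_zariski by (intro exI[of _ "{f}"]) auto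

lemma diagram_variety_subset_Gr: "diagram_variety k m D \<subseteq> Gr k m"
  using closure_of_subset_topspace[of "zariski k m"] by (auto simp: diagram_variety_def topspace_zariski)

lemma diagram_chart_subset_variety:
  "{rowspan_aug n (2 * n) A | A. \<forall>(i, j)\<in>D. A i j = 0} \<subseteq> diagram_variety n (2 * n) D"
  unfolding diagram_variety_def
  by (rule closure_of_subset) (auto simp: topspace_zariski rowspan_aug_in_Gr)

text \<open>The chart is dense in the diagram variety, so some point of it lies outside
  \<open>T\<close>, and one of the equations of \<open>T\<close> fails there.\<close>

lemma diagram_chart_avoids_proper_closed:
  assumes T: "closedin (zariski n (2 * n)) T" and "\<not> diagram_variety n (2 * n) D \<subseteq> T"
  obtains A f d where "\<And>i j. (i, j) \<in> D \<Longrightarrow> A i j = 0" "f \<in> forms n (2 * n) d"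
    "f (pluecker n (aug_row n A)) \<noteq> 0" "\<And>V. V \<in> T \<Longrightarrow> vanishes_at n f V"
proof -
  have "\<not> {rowspan_aug n (2 * n) A | A. \<forall>(i, j)\<in>D. A i j = 0} \<subseteq> T"
    using closure_of_minimal[OF _ T] assms(2) unfolding diagram_variety_def by blast
  then obtain A where A: "\<forall>(i, j)\<in>D. A i j = 0" "rowspan_aug n (2 * n) A \<notin> T" by blast
  obtain F where F: "F \<subseteq> (\<Union>d. forms n (2 * n) d)" "T = zero_locus n (2 * n) F"
    using T unfolding closedin_zariski by blast
  have "\<not> (\<forall>f\<in>F. vanishes_at n f (rowspan_aug n (2 * n) A))"
    using A(2) rowspan_aug_in_Gr[of n A] by (simp add: F(2) zero_locus_def)
  then obtain f where f: "f \<in> F" "\<not> vanishes_at n f (rowspan_aug n (2 * n) A)" by blast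
  then obtain d where d: "f \<in> forms n (2 * n) d" using F(1) by blast
  have "f (pluecker n (aug_row n A)) \<noteq> 0"
    using f(2) unfolding vanishes_at_iff[OF d rowspan_aug_eq_span[symmetric]] .
  moreover have "vanishes_at n f V" if "V \<in> T" for V
    using that f(1) by (simp add: F(2) zero_locus_def)
  moreover have "A i j = 0" if "(i, j) \<in> D" for i j using A(1) that by blast
  ultimately show ?thesis using that d by blast
qed

text \<open>Two proper closed subsets covering the variety would each miss a chart point. The line
  of matrices joining these points keeps the zeros prescribed by \<open>D\<close>, and on it one of
  two nonzero polynomials would always vanish.\<close>

lemma irreducible_diagram_variety:
  "irreducible_space (subtopology (zariski n (2 * n)) (diagram_variety n (2 * n) D))"
proof -
  let ?Z = "zariski n (2 * n)" and ?X = "diagram_variety n (2 * n) D"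
  have top: "topspace (subtopology ?Z ?X) = ?X"
    using diagram_variety_subset_Gr[of n "2 * n" D] by (auto simp: topspace_zariski)
  have "rowspan_aug n (2 * n) (\<lambda>_ _. 0) \<in> ?X"
    by (rule subsetD[OF diagram_chart_subset_variety]) auto
  moreover have "P = ?X \<or> Q = ?X"
    if P: "closedin (subtopology ?Z ?X) P" and Q: "closedin (subtopology ?Z ?X) Q" and PQ: "P \<union> Q = ?X" for P Q
  proof (rule ccontr)
    assume neq: "\<not> (P = ?X \<or> Q = ?X)"
    obtain S T where S: "closedin ?Z S" "P = S \<inter> ?X" and T: "closedin ?Z T" "Q = T \<inter> ?X"
      using P Q unfolding closedin_subtopology by blast
    have nS: "\<not> ?X \<subseteq> S" and nT: "\<not> ?X \<subseteq> T" using neq S(2) T(2) by blast+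
    obtain A f d where A: "\<And>i j. (i, j) \<in> D \<Longrightarrow> A i j = 0" and f: "f \<in> forms n (2 * n) d"
        "f (pluecker n (aug_row n A)) \<noteq> 0" "\<And>V. V \<in> S \<Longrightarrow> vanishes_at n f V"
      using diagram_chart_avoids_proper_closed[OF S(1) nS] by metis
    obtain B g e where B: "\<And>i j. (i, j) \<in> D \<Longrightarrow> B i j = 0" and g: "g \<in> forms n (2 * n) e"
        "g (pluecker n (aug_row n B)) \<noteq> 0" "\<And>V. V \<in> T \<Longrightarrow> vanishes_at n g V"
      using diagram_chart_avoids_proper_closed[OF T(1) nT] by metis
    define L where "L s i j = A i j + s * (B i j - A i j)" for s i j
    have L01: "L 0 = A" "L 1 = B" by (simp_all add: L_def fun_eq_iff)
    have poly: "univariate_poly (\<lambda>s. h (pluecker n (aug_row n (L s))))" if "h \<in> forms n (2 * n) d'" for h d'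
    proof (rule univariate_poly_poly_funs[where f = h and p = "\<lambda>s. pluecker n (aug_row n (L s))"])
      show "h \<in> poly_funs {I. I \<subseteq> {1..2 * n} \<and> card I = n}" using that by (simp add: forms_def)
      show "univariate_poly (\<lambda>s. pluecker n (aug_row n (L s)) I)" for I
        unfolding aug_row_def L_def by (intro univariate_poly_pluecker univariate_poly_intros)
    qed
    have "g (pluecker n (aug_row n (L s))) = 0" if nz: "f (pluecker n (aug_row n (L s))) \<noteq> 0" for s
    proof -
      let ?V = "rowspan_aug n (2 * n) (L s)"
      have "\<forall>(i, j)\<in>D. L s i j = 0" using A B by (auto simp: L_def)
      hence "?V \<in> ?X" using diagram_chart_subset_variety by blast
      moreover have "?V \<notin> S"
        using f(3)[of ?V] nz unfolding vanishes_at_iff[OF f(1) rowspan_aug_eq_span[symmetric]] by blast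
      ultimately have "?V \<in> T" using PQ S(2) T(2) by blast
      thus ?thesis
        using g(3)[of ?V] unfolding vanishes_at_iff[OF g(1) rowspan_aug_eq_span[symmetric]] by blast
    qed
    hence "g (pluecker n (aug_row n (L 1))) = 0"
      using univariate_poly_eq_0[OF poly[OF f(1)] poly[OF g(1)], of 0 1] f(2) by (simp add: L01)
    thus False using g(2) by (simp add: L01)
  qed
  ultimately show ?thesis unfolding irreducible_space_def top by blast
qed

text \<open>An irreducible \<open>E\<close> between \<open>C\<close> and \<open>L\<close> is covered
  by \<open>C\<close> and \<open>H\<close>. It is not contained in \<open>H\<close>, because
  \<open>C\<close> is not, so it is contained in \<open>C\<close>.\<close>

lemma irreducible_component_if_locally_equal:
  assumes L: "closedin (zariski k m) L" and C: "closedin (zariski k m) C" "C \<subseteq> L"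
    and irr: "irreducible_space (subtopology (zariski k m) C)"
    and H: "closedin (zariski k m) H" "L - H \<subseteq> C" "\<not> C \<subseteq> H"
  shows "irreducible_component_of (subtopology (zariski k m) L) C"
proof -
  let ?Z = "zariski k m"
  have sub: "subtopology (subtopology ?Z L) E = subtopology ?Z E" if "E \<subseteq> L" for E
    using that by (simp add: subtopology_subtopology Int_absorb1)
  have top: "topspace (subtopology ?Z E) = E" if "E \<subseteq> L" for E
    using that closedin_subset[OF L] by auto
  have "E = C" if E: "C \<subseteq> E" "E \<subseteq> L" "irreducible_space (subtopology ?Z E)" for E
  proof -
    have "closedin (subtopology ?Z E) (C \<inter> E)" "closedin (subtopology ?Z E) (H \<inter> E)"
      using C(1) H(1) by (auto simp: closedin_subtopology)
    moreover have "(C \<inter> E) \<union> (H \<inter> E) = E" using E(2) H(2) by blast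
    ultimately have "C \<inter> E = E \<or> H \<inter> E = E"
      using E(3) unfolding irreducible_space_def top[OF E(2)] by blast
    thus ?thesis using E(1) H(3) by blast
  qed
  thus ?thesis unfolding irreducible_component_of_def top[OF order_refl]
    using C(2) irr sub by metis
qed

theorem theorem5p5:
  fixes n :: nat and w :: "nat \<Rightarrow> nat"
  assumes "w permutes {1..n}"
  shows "irreducible_component_of
    (scheme_space n (2 * n)
      (flat_limit n (2 * n)
        (\<lambda>t. (\<lambda>V. perm_shift_map n t w ` V) ` rank_variety (2 * n) (perm_rank_set n w))))
    (diagram_variety n (2 * n) (perm_diagram n w))"
proof -
  let ?Z = "zariski n (2 * n)" and ?\<Sigma> = "rank_variety (2 * n) (perm_rank_set n w)"
    and ?D = "perm_diagram n w"
  let ?X = "diagram_variety n (2 * n) ?D"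
  define J where "J = flat_limit n (2 * n) (\<lambda>t. (\<lambda>V. perm_shift_map n t w ` V) ` ?\<Sigma>)"
  \<comment> \<open>\<open>H\<close> is the complement of the chart of row spaces
    \<open>[A | I]\<close>.\<close>
  define H where "H = zero_locus n (2 * n) {\<lambda>p. p {n + 1..2 * n}}"
  have J_iff: "g \<in> J \<longleftrightarrow> (\<exists>d. \<exists>f \<in> family_forms n (2 * n) d. g = f 0 \<and>
      (\<forall>t. t \<noteq> 0 \<longrightarrow> (\<forall>V\<in>?\<Sigma>. vanishes_at n (f t) (perm_shift_map n t w ` V))))" for g
    unfolding J_def flat_limit_def by auto
  have J_forms: "J \<subseteq> (\<Union>d. forms n (2 * n) d)"
  proof
    fix g assume "g \<in> J"
    then obtain d f where "f \<in> family_forms n (2 * n) d" "g = f 0" unfolding J_iff by blast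
    hence "g \<in> forms n (2 * n) d" using family_forms_specialise by simp
    thus "g \<in> (\<Union>d. forms n (2 * n) d)" by blast
  qed
  have generic: "generic_subspaces n w \<subseteq> ?\<Sigma>"
    unfolding rank_variety_eq_closure_generic[OF assms]
    by (rule closure_of_subset) (auto simp: topspace_zariski generic_subspaces_def)
  have "irreducible_component_of (subtopology ?Z (zero_locus n (2 * n) J)) ?X"
  proof (rule irreducible_component_if_locally_equal)
    show closed: "closedin ?Z (zero_locus n (2 * n) J)"
      using J_forms unfolding closedin_zariski by blast
    show "closedin ?Z ?X" unfolding diagram_variety_def by (rule closedin_closure_of)
    show "?X \<subseteq> zero_locus n (2 * n) J"
      unfolding diagram_variety_def
    proof (rule closure_of_minimal[OF _ closed], rule subsetI)
      fix V assume "V \<in> {rowspan_aug n (2 * n) A | A. \<forall>(i, j)\<in>?D. A i j = 0}"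
      then obtain A where V: "V = rowspan_aug n (2 * n) A" and A: "\<And>i j. (i, j) \<in> ?D \<Longrightarrow> A i j = 0"
        by blast
      have "vanishes_at n g V" if g: "g \<in> J" for g
      proof -
        obtain d f where f: "f \<in> family_forms n (2 * n) d" "g = f 0"
          "\<And>t V. t \<noteq> 0 \<Longrightarrow> V \<in> ?\<Sigma> \<Longrightarrow> vanishes_at n (f t) (perm_shift_map n t w ` V)"
          using g unfolding J_iff by blast
        have "f 0 (pluecker n (aug_row n A)) = 0"
          using generic by (intro diagram_chart_in_limit[OF assms A f(1)] f(3)) auto
        thus ?thesis
          unfolding f(2) V rowspan_aug_eq_span
          by (simp only: vanishes_at_iff[OF family_forms_specialise[OF f(1)] refl])
      qed
      thus "V \<in> zero_locus n (2 * n) J" using rowspan_aug_in_Gr by (simp add: zero_locus_def V)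
    qed
    show "irreducible_space (subtopology ?Z ?X)" by (rule irreducible_diagram_variety)
    show "closedin ?Z H" unfolding H_def by (rule closedin_zero_locus_form[OF right_half_form])
    show "zero_locus n (2 * n) J - H \<subseteq> ?X"
    proof
      fix V assume V: "V \<in> zero_locus n (2 * n) J - H"
      hence Gr: "V \<in> Gr n (2 * n)" by (simp add: zero_locus_def)
      obtain b where b: "cv.span (b ` {1..n}) = V" using Gr_spanning_family Gr by blast
      have "pluecker n b {n + 1..2 * n} \<noteq> 0"
        using V Gr vanishes_at_iff[OF right_half_form b] by (auto simp: H_def zero_locus_def)
      then obtain A where A: "V = rowspan_aug n (2 * n) A" using Gr_right_half_chart[OF Gr b] by blast
      have "A i j = 0" if ij: "(i, j) \<in> ?D" for i j
      proof -
        obtain f where f: "f \<in> family_forms n (2 * n) (1 + n)"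
          "\<And>t V. t \<noteq> 0 \<Longrightarrow> V \<in> ?\<Sigma> \<Longrightarrow> vanishes_at n (f t) (perm_shift_map n t w ` V)"
          "\<And>A. f 0 (pluecker n (aug_row n A)) = 0 \<Longrightarrow> A i j = 0"
          using limit_equation[OF assms ij] by blast
        have "f 0 \<in> J" unfolding J_iff using f(1,2) by blast
        hence "vanishes_at n (f 0) V" using V by (simp add: zero_locus_def)
        thus ?thesis
          unfolding A vanishes_at_iff[OF family_forms_specialise[OF f(1)] rowspan_aug_eq_span[symmetric]]
          by (rule f(3))
      qed
      thus "V \<in> ?X" using diagram_chart_subset_variety[of n ?D] A by blast
    qed
    show "\<not> ?X \<subseteq> H"
    proof
      assume "?X \<subseteq> H"
      moreover have "rowspan_aug n (2 * n) (\<lambda>_ _. 0) \<in> ?X"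
        by (rule subsetD[OF diagram_chart_subset_variety]) auto
      ultimately have "vanishes_at n (\<lambda>p. p {n + 1..2 * n}) (rowspan_aug n (2 * n) (\<lambda>_ _. 0))"
        by (auto simp: H_def zero_locus_def)
      thus False
        unfolding vanishes_at_iff[OF right_half_form rowspan_aug_eq_span[symmetric]]
          pluecker_aug_row_right_half by simp
    qed
  qed
  thus ?thesis by (simp only: scheme_space_def J_def)
qed

end
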